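(* Let $n>2$. There does not exist a Finsler metric on an $n$-dimensional manifold $M$ that is of scalar flag curvature with non-constant flag curvature and is a $GB\widetilde W$ metric.
   Context: Finsler metric: a nonnegative function $F$ on $TM$, smooth on $TM_0=TM\setminus\{0\}$, with $F(\lambda y)=\lambda F(y)$ for $\lambda>0$, such that $g_{ij}(x,y)=\frac12\frac{\partial^2F^2}{\partial y^i\partial y^j}$ is positive definite on $TM_0$; $(g^{ij})$ is the inverse matrix and $y_i=g_{im}y^m$. Einstein summation is used. All tensors are tensor fields along $TM_0$ (their components are functions of $(x,y)$, $y\neq0$). Spray coefficients: $G^i=\frac14 g^{il}\left\{\frac{\partial^2F^2}{\partial x^k\partial y^l}y^k-\frac{\partial F^2}{\partial x^l}\right\}$; $G^i_j=\frac{\partial G^i}{\partial y^j}$, $G^i_{jk}=\frac{\partial^2G^i}{\partial y^j\partial y^k}$. Horizontal covariant derivative of the Berwald connection, denoted $\mid$: with $\frac{\delta}{\delta x^m}=\frac{\partial}{\partial x^m}-G^r_m\frac{\partial}{\partial y^r}$, $T_j{}^i{}_{\mid m}=\frac{\delta T_j{}^i}{\delta x^m}+T_j{}^rG^i_{rm}-T_r{}^iG^r_{jm}$, and analogously for tensors with more indices. Berwald curvature: $B_j{}^i{}_{kl}=\frac{\partial^3G^i}{\partial y^j\partial y^k\partial y^l}$. $GB\widetilde W$ metric (generalized Berwald projective Weyl metric): a Finsler metric for which $B_j{}^i{}_{kl}=\beta_j{}^i{}_{kl}+b_{jkl}y^i$ for some tensors $b_{jkl}$ and $\beta_j{}^i{}_{kl}$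 with $\beta_j{}^i{}_{kl\mid m}y^m=0$. Riemann curvature: $R^i{}_k=2\frac{\partial G^i}{\partial x^k}-y^j\frac{\partial^2G^i}{\partial x^j\partial y^k}+2G^j\frac{\partial^2G^i}{\partial y^j\partial y^k}-\frac{\partial G^i}{\partial y^j}\frac{\partial G^j}{\partial y^k}$. $F$ is of scalar flag curvature if $R^i{}_k=\lambda\,(F^2\delta^i_k-y^iy_k)$ for a scalar function $\lambda=\lambda(x,y)$ on $TM_0$ (the flag curvature); the flag curvature is constant if $\lambda$ is a constant, and non-constant otherwise.
   Formalization: The manifold M is assumed connected; without this the claim fails, e.g. for two disjoint round 3-spheres of different radii, where the flag curvature is a different constant on each component. *)

theory Defs
  imports "HOL-Analysis.Analysis"
begin

section \<open>Smooth maps between normed spaces\<close>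

text \<open>Differentiability is taken at the points of \<open>S\<close> in the whole space, so the two notions below
  are meant for open \<open>S\<close>, the only case in which they are used.\<close>

primrec C_k_on :: "nat \<Rightarrow> 'a::real_normed_vector set \<Rightarrow> ('a \<Rightarrow> 'b::real_normed_vector) \<Rightarrow> bool" where
  "C_k_on 0 S f \<longleftrightarrow> continuous_on S f"
| "C_k_on (Suc k) S f \<longleftrightarrow> (\<forall>x\<in>S. f differentiable (at x)) \<and>
     (\<forall>v. C_k_on k S (\<lambda>x. frechet_derivative f (at x) v))"

definition smooth_on :: "'a::real_normed_vector set \<Rightarrow> ('a \<Rightarrow> 'b::real_normed_vector) \<Rightarrow> bool" where
  "smooth_on S f \<longleftrightarrow> (\<forall>k. C_k_on k S f)"


section \<open>Smooth manifolds\<close>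

text \<open>A chart is a pair of its domain and its coordinate map; the values of the coordinate map
  outside the domain are irrelevant. The dimension is the cardinality of the index type \<open>'n\<close>.\<close>

type_synonym ('m, 'n) chart = "'m set \<times> ('m \<Rightarrow> real ^ 'n)"

definition is_chart :: "'m topology \<Rightarrow> ('m, 'n::finite) chart \<Rightarrow> bool" where
  "is_chart M c \<longleftrightarrow> openin M (fst c) \<and> open (snd c ` fst c) \<and>
     homeomorphic_map (subtopology M (fst c)) (top_of_set (snd c ` fst c)) (snd c)"

definition point_of :: "('m, 'n::finite) chart \<Rightarrow> real ^ 'n \<Rightarrow> 'm" where
  "point_of c = inv_into (fst c) (snd c)"

definition transition :: "('m, 'n::finite) chart \<Rightarrow> ('m, 'n) chart \<Rightarrow> real ^ 'n \<Rightarrow> real ^ 'n" where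
  "transition c d x = snd d (point_of c x)"

definition transition_deriv ::
    "('m, 'n::finite) chart \<Rightarrow> ('m, 'n) chart \<Rightarrow> real ^ 'n \<Rightarrow> real ^ 'n \<Rightarrow> real ^ 'n" where
  "transition_deriv c d x = frechet_derivative (transition c d) (at x)"

text \<open>Manifolds are Hausdorff, second countable and connected. Connectedness is needed for the
  dichotomy between constant and non-constant flag curvature to be the intended one: on a disjoint
  union the curvature could be a different constant on each component.\<close>

definition smooth_manifold :: "'m topology \<Rightarrow> ('m, 'n::finite) chart set \<Rightarrow> bool" where
  "smooth_manifold M A \<longleftrightarrow>
     Hausdorff_space M \<and> second_countable M \<and> connected_space M \<and>
     (\<forall>c\<in>A. is_chart M c) \<and> (\<Union>c\<in>A. fst c) = topspace M \<and>
     (\<forall>c\<in>A. \<forall>d\<in>A. smooth_on (snd c ` (fst c \<inter> fst d)) (transition c d))"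


section \<open>The tangent bundle\<close>

text \<open>A tangent vector at \<open>p\<close> is the family of its components in the charts of the atlas around \<open>p\<close>,
  related by the Jacobians of the coordinate changes. The components in charts that do
  not contain \<open>p\<close> are set to zero, so that equality of tangent vectors is equality of functions.\<close>

type_synonym ('m, 'n) tvec = "('m, 'n) chart \<Rightarrow> real ^ 'n"

definition tangent_space :: "('m, 'n::finite) chart set \<Rightarrow> 'm \<Rightarrow> ('m, 'n) tvec set" where
  "tangent_space A p = {v.
     (\<forall>c\<in>A. \<forall>d\<in>A. p \<in> fst c \<longrightarrow> p \<in> fst d \<longrightarrow> v d = transition_deriv c d (snd c p) (v c)) \<and>
     (\<forall>c. \<not> (c \<in> A \<and> p \<in> fst c) \<longrightarrow> v c = 0)}"

definition TM :: "'m topology \<Rightarrow> ('m, 'n::finite) chart set \<Rightarrow> ('m \<times> ('m, 'n) tvec) set" where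
  "TM M A = {(p, v). p \<in> topspace M \<and> v \<in> tangent_space A p}"

definition TM0 :: "'m topology \<Rightarrow> ('m, 'n::finite) chart set \<Rightarrow> ('m \<times> ('m, 'n) tvec) set" where
  "TM0 M A = {(p, v) \<in> TM M A. v \<noteq> (\<lambda>_. 0)}"

text \<open>The element of the tangent bundle with coordinates \<open>(x, y)\<close> in the chart \<open>c\<close>.\<close>

definition tangent_of ::
    "('m, 'n::finite) chart set \<Rightarrow> ('m, 'n) chart \<Rightarrow> real ^ 'n \<Rightarrow> real ^ 'n \<Rightarrow> 'm \<times> ('m, 'n) tvec" where
  "tangent_of A c x y =
     (point_of c x,
      \<lambda>d. if d \<in> A \<and> point_of c x \<in> fst d then transition_deriv c d x y else 0)"

definition slit_coords :: "('m, 'n::finite) chart \<Rightarrow> ((real ^ 'n) \<times> (real ^ 'n)) set" where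
  "slit_coords c = {(x, y). x \<in> snd c ` fst c \<and> y \<noteq> 0}"


section \<open>Functions of the local coordinates \<open>(x, y)\<close>\<close>

type_synonym 'n fld = "real ^ 'n \<Rightarrow> real ^ 'n \<Rightarrow> real"

definition local_rep ::
    "('m, 'n::finite) chart set \<Rightarrow> ('m \<times> ('m, 'n) tvec \<Rightarrow> real) \<Rightarrow> ('m, 'n) chart \<Rightarrow> 'n fld" where
  "local_rep A f c x y = f (tangent_of A c x y)"

definition dx :: "'n::finite \<Rightarrow> 'n fld \<Rightarrow> 'n fld" where
  "dx k f x y = deriv (\<lambda>t. f (x + t *\<^sub>R axis k 1) y) 0"

definition dy :: "'n::finite \<Rightarrow> 'n fld \<Rightarrow> 'n fld" where
  "dy k f x y = deriv (\<lambda>t. f x (y + t *\<^sub>R axis k 1)) 0"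

abbreviation sq :: "'n fld \<Rightarrow> 'n fld" where
  "sq L \<equiv> \<lambda>x y. (L x y)\<^sup>2"

text \<open>In what follows \<open>L\<close> is the local representation of a Finsler metric in a chart.\<close>

definition g_mat :: "'n::finite fld \<Rightarrow> real ^ 'n \<Rightarrow> real ^ 'n \<Rightarrow> real ^ 'n ^ 'n" where
  "g_mat L x y = (\<chi> i j. (1/2) * dy i (dy j (sq L)) x y)"

definition g_inv :: "'n::finite fld \<Rightarrow> real ^ 'n \<Rightarrow> real ^ 'n \<Rightarrow> real ^ 'n ^ 'n" where
  "g_inv L x y = matrix_inv (g_mat L x y)"

definition y_low :: "'n::finite fld \<Rightarrow> 'n \<Rightarrow> 'n fld" where
  "y_low L i x y = (\<Sum>m\<in>UNIV. g_mat L x y $ i $ m * y $ m)"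

definition spray :: "'n::finite fld \<Rightarrow> 'n \<Rightarrow> 'n fld" where
  "spray L i x y = (1/4) * (\<Sum>l\<in>UNIV. g_inv L x y $ i $ l *
     ((\<Sum>k\<in>UNIV. dx k (dy l (sq L)) x y * y $ k) - dx l (sq L) x y))"

definition spray1 :: "'n::finite fld \<Rightarrow> 'n \<Rightarrow> 'n \<Rightarrow> 'n fld" where
  "spray1 L i j = dy j (spray L i)"

definition spray2 :: "'n::finite fld \<Rightarrow> 'n \<Rightarrow> 'n \<Rightarrow> 'n \<Rightarrow> 'n fld" where
  "spray2 L i j k = dy j (dy k (spray L i))"

text \<open>\<open>berwald L j i k l\<close> is the component with upper index \<open>i\<close> and lower indices \<open>j, k, l\<close>.\<close>

definition berwald :: "'n::finite fld \<Rightarrow> 'n \<Rightarrow> 'n \<Rightarrow> 'n \<Rightarrow> 'n \<Rightarrow> 'n fld" where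
  "berwald L j i k l = dy j (dy k (dy l (spray L i)))"

definition delta :: "'n::finite fld \<Rightarrow> 'n \<Rightarrow> 'n fld \<Rightarrow> 'n fld" where
  "delta L m f x y = dx m f x y - (\<Sum>r\<in>UNIV. spray1 L r m x y * dy r f x y)"

text \<open>Horizontal Berwald derivative of a tensor with one upper index \<open>i\<close> and three lower indices
  \<open>j, k, l\<close> (components \<open>T j i k l\<close>) in the direction \<open>m\<close>.\<close>

definition hcov :: "'n::finite fld \<Rightarrow> ('n \<Rightarrow> 'n \<Rightarrow> 'n \<Rightarrow> 'n \<Rightarrow> 'n fld) \<Rightarrow>
    'n \<Rightarrow> 'n \<Rightarrow> 'n \<Rightarrow> 'n \<Rightarrow> 'n \<Rightarrow> 'n fld" where
  "hcov L T j i k l m x y = delta L m (T j i k l) x y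
     + (\<Sum>r\<in>UNIV. T j r k l x y * spray2 L i r m x y)
     - (\<Sum>r\<in>UNIV. T r i k l x y * spray2 L r j m x y)
     - (\<Sum>r\<in>UNIV. T j i r l x y * spray2 L r k m x y)
     - (\<Sum>r\<in>UNIV. T j i k r x y * spray2 L r l m x y)"

definition riemann :: "'n::finite fld \<Rightarrow> 'n \<Rightarrow> 'n \<Rightarrow> 'n fld" where
  "riemann L i k x y = 2 * dx k (spray L i) x y
     - (\<Sum>j\<in>UNIV. y $ j * dx j (dy k (spray L i)) x y)
     + 2 * (\<Sum>j\<in>UNIV. spray L j x y * dy j (dy k (spray L i)) x y)
     - (\<Sum>j\<in>UNIV. dy j (spray L i) x y * dy k (spray L j) x y)"


section \<open>Finsler metrics\<close>

definition finsler_metric ::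
    "'m topology \<Rightarrow> ('m, 'n::finite) chart set \<Rightarrow> ('m \<times> ('m, 'n) tvec \<Rightarrow> real) \<Rightarrow> bool" where
  "finsler_metric M A F \<longleftrightarrow>
     (\<forall>(p, v)\<in>TM M A. F (p, v) \<ge> 0) \<and>
     (\<forall>(p, v)\<in>TM M A. \<forall>t>0. F (p, \<lambda>c. t *\<^sub>R v c) = t * F (p, v)) \<and>
     (\<forall>c\<in>A. smooth_on (slit_coords c) (\<lambda>(x, y). local_rep A F c x y)) \<and>
     (\<forall>c\<in>A. \<forall>(x, y)\<in>slit_coords c. \<forall>w. w \<noteq> 0 \<longrightarrow>
        (\<Sum>i\<in>UNIV. \<Sum>j\<in>UNIV. g_mat (local_rep A F c) x y $ i $ j * w $ i * w $ j) > 0)"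

text \<open>\<open>jac c d x a j\<close> is \<open>\<partial>x'\<^sup>a/\<partial>x\<^sup>j\<close>, where \<open>x'\<close> are the coordinates of \<open>d\<close> and \<open>x\<close> those of \<open>c\<close>.\<close>

definition jac :: "('m, 'n::finite) chart \<Rightarrow> ('m, 'n) chart \<Rightarrow> real ^ 'n \<Rightarrow> 'n \<Rightarrow> 'n \<Rightarrow> real" where
  "jac c d x a j = transition_deriv c d x (axis j 1) $ a"

text \<open>Smooth tensor fields along the slit tangent bundle, given by their components in every chart
  of the atlas: covariant ones of rank three, and ones with an additional upper
  index (the second of the four). In the second definition the upper index of the left-hand side is
  contracted with the Jacobian, which avoids the inverse Jacobian on the right.\<close>

definition tensor_field_0_3 :: "('m, 'n::finite) chart set \<Rightarrow>
    (('m, 'n) chart \<Rightarrow> 'n \<Rightarrow> 'n \<Rightarrow> 'n \<Rightarrow> 'n fld) \<Rightarrow> bool" where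
  "tensor_field_0_3 A T \<longleftrightarrow>
     (\<forall>c\<in>A. \<forall>j k l. smooth_on (slit_coords c) (\<lambda>(x, y). T c j k l x y)) \<and>
     (\<forall>c\<in>A. \<forall>d\<in>A. \<forall>(x, y)\<in>slit_coords c. point_of c x \<in> fst d \<longrightarrow>
       (\<forall>j k l. T c j k l x y =
          (\<Sum>a\<in>UNIV. \<Sum>b\<in>UNIV. \<Sum>e\<in>UNIV.
             T d a b e (transition c d x) (transition_deriv c d x y) *
             jac c d x a j * jac c d x b k * jac c d x e l)))"

definition tensor_field_1_3 :: "('m, 'n::finite) chart set \<Rightarrow>
    (('m, 'n) chart \<Rightarrow> 'n \<Rightarrow> 'n \<Rightarrow> 'n \<Rightarrow> 'n \<Rightarrow> 'n fld) \<Rightarrow> bool" where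
  "tensor_field_1_3 A T \<longleftrightarrow>
     (\<forall>c\<in>A. \<forall>j i k l. smooth_on (slit_coords c) (\<lambda>(x, y). T c j i k l x y)) \<and>
     (\<forall>c\<in>A. \<forall>d\<in>A. \<forall>(x, y)\<in>slit_coords c. point_of c x \<in> fst d \<longrightarrow>
       (\<forall>j s k l. (\<Sum>i\<in>UNIV. jac c d x s i * T c j i k l x y) =
          (\<Sum>a\<in>UNIV. \<Sum>b\<in>UNIV. \<Sum>e\<in>UNIV.
             T d a s b e (transition c d x) (transition_deriv c d x y) *
             jac c d x a j * jac c d x b k * jac c d x e l)))"

definition GBW_metric ::
    "'m topology \<Rightarrow> ('m, 'n::finite) chart set \<Rightarrow> ('m \<times> ('m, 'n) tvec \<Rightarrow> real) \<Rightarrow> bool" where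
  "GBW_metric M A F \<longleftrightarrow> finsler_metric M A F \<and>
     (\<exists>\<beta> b. tensor_field_1_3 A \<beta> \<and> tensor_field_0_3 A b \<and>
       (\<forall>c\<in>A. \<forall>(x, y)\<in>slit_coords c. \<forall>j i k l.
          berwald (local_rep A F c) j i k l x y = \<beta> c j i k l x y + b c j k l x y * y $ i \<and>
          (\<Sum>m\<in>UNIV. hcov (local_rep A F c) (\<beta> c) j i k l m x y * y $ m) = 0))"

definition has_scalar_flag_curvature :: "('m, 'n::finite) chart set \<Rightarrow>
    ('m \<times> ('m, 'n) tvec \<Rightarrow> real) \<Rightarrow> ('m \<times> ('m, 'n) tvec \<Rightarrow> real) \<Rightarrow> bool" where
  "has_scalar_flag_curvature A F K \<longleftrightarrow>
     (\<forall>c\<in>A. \<forall>(x, y)\<in>slit_coords c. \<forall>i k.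
        riemann (local_rep A F c) i k x y =
        local_rep A K c x y *
          ((local_rep A F c x y)\<^sup>2 * (if i = k then 1 else 0) - y $ i * y_low (local_rep A F c) k x y))"

definition constant_on_TM0 ::
    "'m topology \<Rightarrow> ('m, 'n::finite) chart set \<Rightarrow> ('m \<times> ('m, 'n) tvec \<Rightarrow> real) \<Rightarrow> bool" where
  "constant_on_TM0 M A K \<longleftrightarrow> (\<exists>\<kappa>. \<forall>u\<in>TM0 M A. K u = \<kappa>)"

end

theory Submission
  imports Defs
begin

text \<open>
  Let \<open>E = F\<^sup>2\<close> and write \<open>.k\<close> for \<open>\<partial>/\<partial>y\<^sup>k\<close>. For every spray the cyclic sum of \<open>R\<^sup>i\<^sub>k\<^sub>.\<^sub>l\<^sub>.\<^sub>m\<close> over \<open>k, l, m\<close>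
  is \<open>-3\<close> times the covariant derivative of the Berwald curvature along \<open>y\<close>, which for a
  \<open>GBW\<close> metric is a multiple of \<open>y\<^sup>i\<close>. When \<open>R\<^sup>i\<^sub>k = \<lambda> (E \<delta>\<^sup>i\<^sub>k - y\<^sup>i y\<^sub>k)\<close> this forces
  \<open>E \<lambda>\<^sub>.\<^sub>j\<^sub>.\<^sub>m + (\<lambda>\<^sub>.\<^sub>j E\<^sub>.\<^sub>m + \<lambda>\<^sub>.\<^sub>m E\<^sub>.\<^sub>j) / 2 = 0\<close>. Differentiating and antisymmetrizing shows that
  \<open>\<lambda>\<^sub>.\<^sub>m (E E\<^sub>.\<^sub>j\<^sub>.\<^sub>k - E\<^sub>.\<^sub>j E\<^sub>.\<^sub>k / 2)\<close> is symmetric in \<open>k, m\<close>, and its trace with the inverse metric is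
  \<open>(n - 2) \<lambda>\<^sub>.\<^sub>m = 0\<close>. So \<open>\<lambda>\<close> depends on \<open>x\<close> only, and the Bianchi identity of the horizontal
  derivations (Schur's lemma) makes it locally constant.
\<close>

section \<open>Calculus of smooth functions\<close>

text \<open>The \<open>b\<close>-part of the Berwald curvature is harmless because
  \<open>y $ i\<close> is parallel along the spray: the term \<open>- 2 * G i\<close> from its spray
  derivative cancels against the connection term by Euler's relation. The flag curvature enters as a
  bare function \<lambda> on the slit tangent bundle and cannot be differentiated at once. Its
  smoothness and its homogeneity of degree 0 are read off from the trace of the Riemann curvature,
  (n - 1) \<lambda> E, where E > 0. The factor n - 2 is the trace n - 1 of the angular metric less
  the 1 contributed by the other side of the symmetry, whose remaining term vanishes because
  \<lambda> has degree 0. The dimension enters again in Schur's lemma, where an index distinct from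
  two given ones is needed. The spray is defined through an inverse matrix, so its smoothness rests
  on Cramer's rule and its homogeneity on the injectivity of the metric.\<close>

lemma C_k_on_cong:
  assumes "open S" and "\<And>x. x \<in> S \<Longrightarrow> f x = g x"
  shows "C_k_on k S f \<longleftrightarrow> C_k_on k S g"
  using assms(2)
proof (induction k arbitrary: f g)
  case 0
  then show ?case by (simp cong: continuous_on_cong)
next
  case (Suc k)
  have d: "f differentiable at x \<longleftrightarrow> g differentiable at x" if "x \<in> S" for x
    using that Suc.prems assms(1)
    by (metis differentiable_def has_derivative_transform_within_open)
  \<comment> \<open>\<open>frechet_derivative\<close> is a choice from the predicate
    \<open>has_derivative\<close>. On an open set this predicate is the same for \<open>f\<close>
    and \<open>g\<close>, so the chosen maps coincide.\<close>
  have "frechet_derivative f (at x) = frechet_derivative g (at x)" if "x \<in> S" for x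
  proof -
    have "(f has_derivative D) (at x) \<longleftrightarrow> (g has_derivative D) (at x)" for D
      using that Suc.prems assms(1) by (metis has_derivative_transform_within_open)
    then show ?thesis by (simp add: frechet_derivative_def)
  qed
  then have "C_k_on k S (\<lambda>x. frechet_derivative f (at x) v) \<longleftrightarrow>
      C_k_on k S (\<lambda>x. frechet_derivative g (at x) v)" for v
    by (intro Suc.IH) simp
  then show ?case using d by simp
qed

lemma C_k_on_SucD: "C_k_on (Suc k) S f \<Longrightarrow> C_k_on k S f"
proof (induction k arbitrary: f)
  case 0
  then show ?case
    by (auto simp: continuous_on_eq_continuous_at intro!: continuous_at_imp_continuous_on
        differentiable_imp_continuous_within)
next
  case (Suc k)
  then show ?case by (auto simp del: C_k_on.simps(1))
qed

text \<open>Lets a derivative known in closed form replace the choice operator of the recursive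
  definition, so that the sum, product and inverse rules can be iterated.\<close>

lemma C_k_on_SucI:
  assumes "open S" and "\<And>x. x \<in> S \<Longrightarrow> (f has_derivative D x) (at x)"
    and "\<And>v. C_k_on k S (\<lambda>x. D x v)"
  shows "C_k_on (Suc k) S f"
proof -
  have "frechet_derivative f (at x) = D x" if "x \<in> S" for x
    using frechet_derivative_at[OF assms(2)[OF that]] by simp
  then have "C_k_on k S (\<lambda>x. frechet_derivative f (at x) v) \<longleftrightarrow> C_k_on k S (\<lambda>x. D x v)" for v
    by (intro C_k_on_cong[OF assms(1)]) simp
  then show ?thesis using assms by (auto simp: differentiable_def)
qed

lemma C_k_on_SucE:
  assumes "C_k_on (Suc k) S f" and "x \<in> S"
  shows "(f has_derivative frechet_derivative f (at x)) (at x)"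
  using assms by (simp flip: frechet_derivative_works)

lemma C_k_on_const: "open S \<Longrightarrow> C_k_on k S (\<lambda>_. c)"
proof (induction k arbitrary: c)
  case (Suc k)
  then show ?case by (intro C_k_on_SucI[where D = "\<lambda>_ _. 0"]) auto
qed simp

lemma C_k_on_bounded_linear:
  assumes "open S" "bounded_linear f" shows "C_k_on k S f"
proof (cases k)
  case 0
  then show ?thesis by (simp add: assms linear_continuous_on)
next
  case (Suc m)
  show ?thesis unfolding Suc
    by (rule C_k_on_SucI[where D = "\<lambda>_. f"])
      (auto simp: assms C_k_on_const bounded_linear_imp_has_derivative)
qed

lemma C_k_on_add:
  assumes "open S" "C_k_on k S f" "C_k_on k S g"
  shows "C_k_on k S (\<lambda>x. f x + g x)"
  using assms(2,3)
proof (induction k arbitrary: f g)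
  case 0
  then show ?case by (auto intro: continuous_intros)
next
  case (Suc k)
  show ?case
    by (rule C_k_on_SucI[where D = "\<lambda>x v. frechet_derivative f (at x) v + frechet_derivative g (at x) v"])
      (use Suc assms(1) in \<open>auto intro!: has_derivative_add C_k_on_SucE\<close>)
qed

lemma C_k_on_mult:
  fixes f g :: "'a::real_normed_vector \<Rightarrow> real"
  assumes "open S" "C_k_on k S f" "C_k_on k S g"
  shows "C_k_on k S (\<lambda>x. f x * g x)"
  using assms(2,3)
proof (induction k arbitrary: f g)
  case 0
  then show ?case by (auto intro: continuous_intros)
next
  case (Suc k)
  have fg: "C_k_on k S f" "C_k_on k S g"
    using Suc.prems by (simp_all only: C_k_on_SucD)
  show ?case
    by (rule C_k_on_SucI[where D = "\<lambda>x v. f x * frechet_derivative g (at x) v + frechet_derivative f (at x) v * g x"])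
      (use Suc.prems fg assms(1) in \<open>auto intro!: has_derivative_mult C_k_on_SucE C_k_on_add Suc.IH\<close>)
qed

text \<open>The derivative of an inverse is a product of inverses of \<open>f\<close> with a
  derivative of \<open>f\<close>, so the induction closes one order lower.\<close>

lemma C_k_on_inverse:
  fixes f :: "'a::real_normed_vector \<Rightarrow> real"
  assumes "open S" "C_k_on k S f" "\<And>x. x \<in> S \<Longrightarrow> f x \<noteq> 0"
  shows "C_k_on k S (\<lambda>x. inverse (f x))"
  using assms(2)
proof (induction k)
  case 0
  then show ?case using assms by (auto intro: continuous_intros)
next
  case (Suc k)
  have i: "C_k_on k S (\<lambda>x. inverse (f x))"
    by (rule Suc.IH[OF C_k_on_SucD[OF Suc.prems]])
  have "C_k_on k S (\<lambda>x. (-1) * (inverse (f x) * frechet_derivative f (at x) v * inverse (f x)))" for v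
    using Suc.prems by (intro C_k_on_mult i assms(1) C_k_on_const) auto
  then show ?case
    by (intro C_k_on_SucI[where D = "\<lambda>x v. - (inverse (f x) * frechet_derivative f (at x) v * inverse (f x))"])
      (use Suc assms in \<open>auto intro!: Deriv.has_derivative_inverse C_k_on_SucE\<close>)
qed

lemma smooth_onD: "smooth_on S f \<Longrightarrow> x \<in> S \<Longrightarrow> (f has_derivative frechet_derivative f (at x)) (at x)"
  unfolding smooth_on_def by (meson C_k_on_SucE)

lemma smooth_on_continuous: "smooth_on S f \<Longrightarrow> continuous_on S f"
  unfolding smooth_on_def by (metis C_k_on.simps(1))

lemma smooth_on_frechet: "smooth_on S f \<Longrightarrow> smooth_on S (\<lambda>x. frechet_derivative f (at x) v)"
  unfolding smooth_on_def by (metis C_k_on.simps(2))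

lemma smooth_on_cong:
  "open S \<Longrightarrow> (\<And>x. x \<in> S \<Longrightarrow> f x = g x) \<Longrightarrow> smooth_on S f \<longleftrightarrow> smooth_on S g"
  unfolding smooth_on_def by (metis C_k_on_cong)

lemma smooth_on_sum:
  assumes "open S" "\<And>i. i \<in> I \<Longrightarrow> smooth_on S (f i)"
  shows "smooth_on S (\<lambda>x. \<Sum>i\<in>I. f i x)"
  using assms(2)
  by (induction I rule: infinite_finite_induct)
    (auto simp: smooth_on_def assms(1) C_k_on_const C_k_on_add)

lemma smooth_on_prod:
  fixes f :: "'i \<Rightarrow> 'a::real_normed_vector \<Rightarrow> real"
  assumes "open S" "\<And>i. i \<in> I \<Longrightarrow> smooth_on S (f i)"
  shows "smooth_on S (\<lambda>x. \<Prod>i\<in>I. f i x)"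
  using assms(2)
  by (induction I rule: infinite_finite_induct)
    (auto simp: smooth_on_def assms(1) C_k_on_const C_k_on_mult)

lemma smooth_on_det:
  fixes M :: "'a::real_normed_vector \<Rightarrow> real ^ 'n ^ 'n::finite"
  assumes "open S" "\<And>i j. smooth_on S (\<lambda>x. M x $ i $ j)"
  shows "smooth_on S (\<lambda>x. det (M x))"
proof -
  have "smooth_on S (\<lambda>x. of_int (sign p) * (\<Prod>i\<in>UNIV. M x $ i $ p i))" for p
    using smooth_on_prod[OF assms(1), of UNIV "\<lambda>i x. M x $ i $ p i"] assms
    by (simp add: smooth_on_def C_k_on_mult C_k_on_const)
  then show ?thesis
    unfolding det_def by (intro smooth_on_sum assms(1)) auto
qed

section \<open>Symmetry of second derivatives\<close>

lemma double_difference_mean_value: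
  fixes f :: "'a::real_normed_vector \<Rightarrow> real"
  assumes ball: "ball p r \<subseteq> S" and f: "\<And>q. q \<in> S \<Longrightarrow> (f has_derivative f' q) (at q)"
    and fu: "\<And>q. q \<in> S \<Longrightarrow> ((\<lambda>q. f' q u) has_derivative f'' q) (at q)"
    and h: "0 < h" "h * (norm u + norm v) < r"
  shows "\<exists>q\<in>ball p r. f (p + h *\<^sub>R u + h *\<^sub>R v) - f (p + h *\<^sub>R u) - f (p + h *\<^sub>R v) + f p
    = h * h * f'' q v"
proof -
  have inb: "p + s *\<^sub>R u + t *\<^sub>R v \<in> ball p r" if "0 \<le> s" "s \<le> h" "0 \<le> t" "t \<le> h" for s t
  proof -
    have "norm (s *\<^sub>R u + t *\<^sub>R v) \<le> s * norm u + t * norm v"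
      using norm_triangle_ineq[of "s *\<^sub>R u" "t *\<^sub>R v"] that by simp
    also have "\<dots> \<le> h * norm u + h * norm v"
      using that by (intro add_mono mult_right_mono) auto
    also have "\<dots> < r" using h by (simp add: algebra_simps)
    finally have "dist (p + (s *\<^sub>R u + t *\<^sub>R v)) p < r" by (simp add: dist_norm)
    then show ?thesis by (simp add: add.assoc dist_commute)
  qed
  have line: "((\<lambda>s. f (p + s *\<^sub>R u + t *\<^sub>R v)) has_real_derivative f' (p + s *\<^sub>R u + t *\<^sub>R v) u) (at s)"
    if "0 \<le> s" "s \<le> h" "0 \<le> t" "t \<le> h" for s t
  proof -
    have d: "(f has_derivative f' (p + s *\<^sub>R u + t *\<^sub>R v)) (at (p + s *\<^sub>R u + t *\<^sub>R v))"
      using inb[OF that] ball f by blast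
    have "((\<lambda>s. p + s *\<^sub>R u + t *\<^sub>R v) has_derivative (\<lambda>c. c *\<^sub>R u)) (at s)"
      by (auto intro!: derivative_eq_intros)
    from has_derivative_compose[OF this d]
    show ?thesis
      by (rule has_derivative_imp_has_field_derivative)
        (simp add: linear_simps has_derivative_bounded_linear[OF d] mult.commute)
  qed
  \<comment> \<open>The second difference is the increment of \<open>g\<close> over
    \<open>[0, h]\<close>. One mean value step along \<open>u\<close> and one along \<open>v\<close>
    therefore produce the mixed derivative.\<close>
  define g where "g = (\<lambda>s. f (p + s *\<^sub>R u + h *\<^sub>R v) - f (p + s *\<^sub>R u + 0 *\<^sub>R v))"
  define g' where "g' = (\<lambda>s. f' (p + s *\<^sub>R u + h *\<^sub>R v) u - f' (p + s *\<^sub>R u + 0 *\<^sub>R v) u)"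
  have "(g has_real_derivative g' s) (at s)" if "0 \<le> s" "s \<le> h" for s
    unfolding g_def g'_def using that h by (intro DERIV_diff line) auto
  from MVT2[OF h(1), of g g'] this
  obtain \<xi> where \<xi>: "0 < \<xi>" "\<xi> < h" "g h - g 0 = h * g' \<xi>" by auto
  have "((\<lambda>t. f' (p + \<xi> *\<^sub>R u + t *\<^sub>R v) u) has_real_derivative f'' (p + \<xi> *\<^sub>R u + t *\<^sub>R v) v) (at t)"
    if "0 \<le> t" "t \<le> h" for t
  proof -
    have d: "((\<lambda>q. f' q u) has_derivative f'' (p + \<xi> *\<^sub>R u + t *\<^sub>R v)) (at (p + \<xi> *\<^sub>R u + t *\<^sub>R v))"
      using inb[of \<xi> t] that \<xi> ball fu by (meson less_imp_le subsetD)
    have "((\<lambda>t. p + \<xi> *\<^sub>R u + t *\<^sub>R v) has_derivative (\<lambda>c. c *\<^sub>R v)) (at t)"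
      by (auto intro!: derivative_eq_intros)
    from has_derivative_compose[OF this d]
    show ?thesis
      by (rule has_derivative_imp_has_field_derivative)
        (simp add: linear_simps has_derivative_bounded_linear[OF d] mult.commute)
  qed
  from MVT2[OF h(1), of "\<lambda>t. f' (p + \<xi> *\<^sub>R u + t *\<^sub>R v) u" "\<lambda>t. f'' (p + \<xi> *\<^sub>R u + t *\<^sub>R v) v"] this
  obtain \<eta> where \<eta>: "0 < \<eta>" "\<eta> < h" "g' \<xi> = h * f'' (p + \<xi> *\<^sub>R u + \<eta> *\<^sub>R v) v"
    unfolding g'_def by auto
  have "p + \<xi> *\<^sub>R u + \<eta> *\<^sub>R v \<in> ball p r" using inb \<xi> \<eta> by simp
  moreover have "f (p + h *\<^sub>R u + h *\<^sub>R v) - f (p + h *\<^sub>R u) - f (p + h *\<^sub>R v) + f p = g h - g 0"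
    by (simp add: g_def)
  ultimately show ?thesis using \<xi>(3) \<eta>(3) by (auto simp: mult.assoc)
qed

text \<open>The same second difference is \<open>h * h\<close> times either mixed derivative, each
  taken at its own point near \<open>p\<close>. Continuity of the mixed derivatives then forbids
  them to differ at \<open>p\<close>.\<close>

lemma frechet_derivative_commute:
  fixes f :: "'a::real_normed_vector \<Rightarrow> real"
  assumes "open S" "smooth_on S f" "p \<in> S"
  shows "frechet_derivative (\<lambda>q. frechet_derivative f (at q) u) (at p) v =
         frechet_derivative (\<lambda>q. frechet_derivative f (at q) v) (at p) u"
proof (rule ccontr)
  define A where "A = (\<lambda>u v p. frechet_derivative (\<lambda>q. frechet_derivative f (at q) u) (at p) v)"
  assume "\<not> ?thesis"
  then have e: "dist (A u v p) (A v u p) > 0" (is "?e > 0") by (simp add: A_def)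
  have "isCont (A a b) p" for a b
    using smooth_on_continuous[OF smooth_on_frechet[OF smooth_on_frechet[OF assms(2)]]] assms(1,3)
    unfolding A_def by (simp add: continuous_on_eq_continuous_at)
  then have "\<exists>d>0. \<forall>q. dist q p < d \<longrightarrow> dist (A a b q) (A a b p) < ?e / 2" for a b
    using e unfolding continuous_at_eps_delta by (meson half_gt_zero)
  then obtain d1 d2 where d: "d1 > 0" "d2 > 0"
    "\<And>q. dist q p < d1 \<Longrightarrow> dist (A u v q) (A u v p) < ?e / 2"
    "\<And>q. dist q p < d2 \<Longrightarrow> dist (A v u q) (A v u p) < ?e / 2" by metis
  obtain d3 where d3: "d3 > 0" "ball p d3 \<subseteq> S" using assms(1,3) open_contains_ball by blast
  define r where "r = min d3 (min d1 d2)"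
  have r: "r > 0" "ball p r \<subseteq> S" using d d3 by (auto simp: r_def)
  \<comment> \<open>The 1 keeps the denominator positive when \<open>u\<close> and \<open>v\<close>
    are both 0; the 2 keeps the parallelogram well inside the ball.\<close>
  define h where "h = r / (2 * (norm u + norm v + 1))"
  have pos: "norm u + norm v + 1 > 0" by (simp add: add_nonneg_pos)
  have h0: "h > 0" using r pos by (simp add: h_def)
  have "h * (norm u + norm v) \<le> h * (norm u + norm v + 1)" using h0 by simp
  also have "\<dots> = r / 2" using pos by (simp add: h_def field_simps)
  finally have h: "h > 0" "h * (norm u + norm v) < r" "h * (norm v + norm u) < r"
    using r h0 by (auto simp: add.commute)
  have "\<exists>q\<in>ball p r. f (p + h *\<^sub>R u + h *\<^sub>R v) - f (p + h *\<^sub>R u) - f (p + h *\<^sub>R v) + f p = h * h * A u v q"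
    unfolding A_def
    by (rule double_difference_mean_value[OF r(2) _ _ h(1,2)])
      (auto intro: smooth_onD assms smooth_on_frechet)
  then obtain q1 where q1: "q1 \<in> ball p r"
    "f (p + h *\<^sub>R u + h *\<^sub>R v) - f (p + h *\<^sub>R u) - f (p + h *\<^sub>R v) + f p = h * h * A u v q1" by blast
  have "\<exists>q\<in>ball p r. f (p + h *\<^sub>R v + h *\<^sub>R u) - f (p + h *\<^sub>R v) - f (p + h *\<^sub>R u) + f p = h * h * A v u q"
    unfolding A_def
    by (rule double_difference_mean_value[OF r(2) _ _ h(1,3)])
      (auto intro: smooth_onD assms smooth_on_frechet)
  then obtain q2 where q2: "q2 \<in> ball p r"
    "f (p + h *\<^sub>R v + h *\<^sub>R u) - f (p + h *\<^sub>R v) - f (p + h *\<^sub>R u) + f p = h * h * A v u q2" by blast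
  have "h * h * A u v q1 = h * h * A v u q2"
    using q1(2) q2(2) by (simp add: algebra_simps)
  then have "A u v q1 = A v u q2" using h(1) by simp
  moreover have "dist (A u v q1) (A u v p) < ?e / 2" "dist (A v u q2) (A v u p) < ?e / 2"
    using q1(1) q2(1) d(3)[of q1] d(4)[of q2] by (auto simp: r_def dist_commute)
  ultimately show False
    using dist_triangle_half_l by (metis dist_commute less_irrefl)
qed

section \<open>Partial derivatives in the coordinates of the tangent bundle\<close>

lemma sum_kronecker [simp]:
  fixes f :: "'n::finite \<Rightarrow> real"
  shows "(\<Sum>k\<in>UNIV. (if k = l then 1 else 0) * f k) = f l"
    and "(\<Sum>k\<in>UNIV. (if l = k then 1 else 0) * f k) = f l"
    and "(\<Sum>k\<in>UNIV. f k * (if k = l then 1 else 0)) = f l"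
    and "(\<Sum>k\<in>UNIV. f k * (if l = k then 1 else 0)) = f l"
  by (simp_all add: if_distrib[of "\<lambda>c. c * _"] if_distrib[of "\<lambda>c. _ * c"] cong: if_cong)

locale coordinate_domain =
  fixes S :: "((real ^ 'n::finite) \<times> (real ^ 'n)) set"
  assumes open_S: "open S"
begin

definition sm :: "'n fld \<Rightarrow> bool" where
  "sm f \<longleftrightarrow> smooth_on S (case_prod f)"

text \<open>The common form of \<open>dx k\<close> and \<open>dy k\<close>: the rules of calculus
  and the commutation of derivatives are proved once, for an arbitrary fixed direction.\<close>

definition partial :: "('n fld \<Rightarrow> 'n fld) \<Rightarrow> bool" where
  "partial D \<longleftrightarrow> (\<exists>v. \<forall>f x y. sm f \<longrightarrow> (x, y) \<in> S \<longrightarrow>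
     D f x y = frechet_derivative (case_prod f) (at (x, y)) v)"

lemma sm_has_derivative:
  "sm f \<Longrightarrow> (x, y) \<in> S \<Longrightarrow>
    (case_prod f has_derivative frechet_derivative (case_prod f) (at (x, y))) (at (x, y))"
  unfolding sm_def by (rule smooth_onD)

lemma sm_cong: "(\<And>x y. (x, y) \<in> S \<Longrightarrow> f x y = g x y) \<Longrightarrow> sm f \<longleftrightarrow> sm g"
  unfolding sm_def by (rule smooth_on_cong[OF open_S]) auto

lemma sm_const [simp]: "sm (\<lambda>x y. c)"
  using C_k_on_const[OF open_S] by (auto simp: sm_def smooth_on_def case_prod_unfold)

lemma sm_add [simp]: "sm f \<Longrightarrow> sm g \<Longrightarrow> sm (\<lambda>x y. f x y + g x y)"
  using C_k_on_add[OF open_S] by (fastforce simp: sm_def smooth_on_def case_prod_unfold)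

lemma sm_mult [simp]: "sm f \<Longrightarrow> sm g \<Longrightarrow> sm (\<lambda>x y. f x y * g x y)"
  using C_k_on_mult[OF open_S] by (fastforce simp: sm_def smooth_on_def case_prod_unfold)

lemma sm_uminus [simp]: "sm f \<Longrightarrow> sm (\<lambda>x y. - f x y)"
  using sm_mult[of "\<lambda>x y. -1" f] by simp

lemma sm_diff [simp]: "sm f \<Longrightarrow> sm g \<Longrightarrow> sm (\<lambda>x y. f x y - g x y)"
  using sm_add[of f "\<lambda>x y. - g x y"] by simp

lemma sm_power2 [simp]: "sm f \<Longrightarrow> sm (sq f)"
  unfolding power2_eq_square by simp

lemma sm_sum [simp]: "(\<And>i. i \<in> I \<Longrightarrow> sm (f i)) \<Longrightarrow> sm (\<lambda>x y. \<Sum>i\<in>I. f i x y)"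
  using smooth_on_sum[OF open_S, of I "\<lambda>i. case_prod (f i)"] by (simp add: sm_def case_prod_unfold)

lemma sm_divide:
  assumes "sm f" "sm g" "\<And>x y. (x, y) \<in> S \<Longrightarrow> g x y \<noteq> 0"
  shows "sm (\<lambda>x y. f x y / g x y)"
proof -
  have "smooth_on S (\<lambda>p. inverse (case_prod g p))"
    using assms(2,3) C_k_on_inverse[OF open_S] by (auto simp: sm_def smooth_on_def)
  then have "sm (\<lambda>x y. inverse (g x y))" by (simp add: sm_def case_prod_unfold)
  then show ?thesis using sm_mult[OF assms(1)] by (simp add: divide_inverse)
qed

lemma sm_det:
  assumes "\<And>i j. sm (\<lambda>x y. M x y $ i $ j)"
  shows "sm (\<lambda>x y. det (M x y :: real ^ 'm::finite ^ 'm))"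
  using smooth_on_det[OF open_S, of "case_prod M"] assms by (simp add: sm_def case_prod_unfold)

lemma sm_coord [simp]: "sm (\<lambda>x y. y $ i)"
proof -
  have "bounded_linear (\<lambda>p::(real ^ 'n) \<times> (real ^ 'n). snd p $ i)"
    by (intro bounded_linear_compose[OF bounded_linear_vec_nth] bounded_linear_snd)
  then show ?thesis
    using C_k_on_bounded_linear[OF open_S] by (auto simp: sm_def smooth_on_def case_prod_unfold)
qed

definition direction :: "('n fld \<Rightarrow> 'n fld) \<Rightarrow> (real ^ 'n) \<times> (real ^ 'n)" where
  "direction D = (SOME v. \<forall>f x y. sm f \<longrightarrow> (x, y) \<in> S \<longrightarrow>
     D f x y = frechet_derivative (case_prod f) (at (x, y)) v)"

lemma dx_frechet:
  assumes "sm f" "(x, y) \<in> S"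
  shows "dx k f x y = frechet_derivative (case_prod f) (at (x, y)) (axis k 1, 0)"
proof -
  note d = sm_has_derivative[OF assms]
  have "((\<lambda>t. (x + t *\<^sub>R axis k 1, y)) has_derivative (\<lambda>t. (t *\<^sub>R axis k 1, 0))) (at 0)"
    by (auto intro!: derivative_eq_intros)
  from has_derivative_compose[OF this, of "case_prod f"] d
  have "((\<lambda>t. f (x + t *\<^sub>R axis k 1) y) has_derivative
      (\<lambda>t. frechet_derivative (case_prod f) (at (x, y)) (t *\<^sub>R (axis k 1, 0)))) (at 0)" by simp
  then show ?thesis
    unfolding dx_def
    by (intro DERIV_imp_deriv has_derivative_imp_has_field_derivative)
      (simp_all only: linear_simps has_derivative_bounded_linear[OF d] mult.commute real_scaleR_def)
qed

lemma dy_frechet: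
  assumes "sm f" "(x, y) \<in> S"
  shows "dy k f x y = frechet_derivative (case_prod f) (at (x, y)) (0, axis k 1)"
proof -
  note d = sm_has_derivative[OF assms]
  have "((\<lambda>t. (x, y + t *\<^sub>R axis k 1)) has_derivative (\<lambda>t. (0, t *\<^sub>R axis k 1))) (at 0)"
    by (auto intro!: derivative_eq_intros)
  from has_derivative_compose[OF this, of "case_prod f"] d
  have "((\<lambda>t. f x (y + t *\<^sub>R axis k 1)) has_derivative
      (\<lambda>t. frechet_derivative (case_prod f) (at (x, y)) (t *\<^sub>R (0, axis k 1)))) (at 0)" by simp
  then show ?thesis
    unfolding dy_def
    by (intro DERIV_imp_deriv has_derivative_imp_has_field_derivative)
      (simp_all only: linear_simps has_derivative_bounded_linear[OF d] mult.commute real_scaleR_def)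
qed

lemma frechet_eq_dx_dy:
  assumes "sm f" "(x, y) \<in> S"
  shows "frechet_derivative (case_prod f) (at (x, y)) (u, v) =
    (\<Sum>k\<in>UNIV. u $ k * dx k f x y) + (\<Sum>k\<in>UNIV. v $ k * dy k f x y)"
proof -
  let ?d = "frechet_derivative (case_prod f) (at (x, y))"
  have lin: "linear ?d"
    using has_derivative_bounded_linear[OF sm_has_derivative[OF assms]] bounded_linear.linear by blast
  have "(u, v) = (\<Sum>k\<in>UNIV. u $ k *\<^sub>R (axis k (1::real), 0::real ^ 'n)) + (\<Sum>k\<in>UNIV. v $ k *\<^sub>R (0::real ^ 'n, axis k (1::real)))"
    by (auto simp: prod_eq_iff fst_sum snd_sum vec_eq_iff axis_def)
  then have "?d (u, v) = (\<Sum>k\<in>UNIV. u $ k * ?d (axis k 1, 0)) + (\<Sum>k\<in>UNIV. v $ k * ?d (0, axis k 1))"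
    by (simp only: linear_add[OF lin] linear_sum[OF lin] linear_scale[OF lin] real_scaleR_def)
  then show ?thesis using assms by (simp add: dx_frechet dy_frechet)
qed

lemma partial_dx [simp]: "partial (dx k)"
  unfolding partial_def using dx_frechet by blast

lemma partial_dy [simp]: "partial (dy k)"
  unfolding partial_def using dy_frechet by blast

context
  fixes D :: "'n fld \<Rightarrow> 'n fld"
  assumes D: "partial D"
begin

lemma partial_eq_frechet:
  "sm f \<Longrightarrow> (x, y) \<in> S \<Longrightarrow> D f x y = frechet_derivative (case_prod f) (at (x, y)) (direction D)"
  using someI_ex[OF D[unfolded partial_def]] unfolding direction_def by blast

lemma partial_eq:
  assumes "sm f" "(x, y) \<in> S" "(case_prod f has_derivative f') (at (x, y))"
  shows "D f x y = f' (direction D)"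
  using partial_eq_frechet[OF assms(1,2)] frechet_derivative_at[OF assms(3)] by simp

lemma partial_const: "(x, y) \<in> S \<Longrightarrow> D (\<lambda>x y. c) x y = 0"
  by (subst partial_eq[where f' = "\<lambda>_. 0"]) (auto simp: case_prod_unfold)

lemma partial_cong:
  assumes "\<And>x y. (x, y) \<in> S \<Longrightarrow> f x y = g x y" "sm f" "(x, y) \<in> S"
  shows "D f x y = D g x y"
proof -
  have "sm g" using sm_cong[of f g, OF assms(1)] assms(2) by simp
  have "(case_prod g has_derivative frechet_derivative (case_prod f) (at (x, y))) (at (x, y))"
    by (rule has_derivative_transform_within_open[OF sm_has_derivative[OF assms(2,3)] open_S])
      (use assms in auto)
  then show ?thesis
    using partial_eq[OF \<open>sm g\<close> assms(3)] partial_eq_frechet[OF assms(2,3)] by simp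
qed

lemma partial_add:
  assumes "sm f" "sm g" "(x, y) \<in> S"
  shows "D (\<lambda>x y. f x y + g x y) x y = D f x y + D g x y"
proof -
  have "((\<lambda>(x, y). f x y + g x y) has_derivative (\<lambda>v. frechet_derivative (case_prod f) (at (x, y)) v
     + frechet_derivative (case_prod g) (at (x, y)) v)) (at (x, y))"
    using has_derivative_add[OF sm_has_derivative[OF assms(1,3)] sm_has_derivative[OF assms(2,3)]]
    by (simp add: case_prod_unfold)
  then show ?thesis
    by (subst partial_eq) (use assms in \<open>simp_all add: partial_eq_frechet\<close>)
qed

lemma partial_mult:
  assumes "sm f" "sm g" "(x, y) \<in> S"
  shows "D (\<lambda>x y. f x y * g x y) x y = f x y * D g x y + D f x y * g x y"
proof -
  have "((\<lambda>(x, y). f x y * g x y) has_derivative (\<lambda>v. f x y * frechet_derivative (case_prod g) (at (x, y)) v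
     + frechet_derivative (case_prod f) (at (x, y)) v * g x y)) (at (x, y))"
    using has_derivative_mult[OF sm_has_derivative[OF assms(1,3)] sm_has_derivative[OF assms(2,3)]]
    by (simp add: case_prod_unfold)
  then show ?thesis
    by (subst partial_eq) (use assms in \<open>simp_all add: partial_eq_frechet\<close>)
qed

lemma partial_cmult:
  assumes "sm g" "(x, y) \<in> S"
  shows "D (\<lambda>x y. c * g x y) x y = c * D g x y"
  using partial_mult[of "\<lambda>x y. c" g x y] assms by (simp add: partial_const)

lemma partial_uminus:
  assumes "sm g" "(x, y) \<in> S"
  shows "D (\<lambda>x y. - g x y) x y = - D g x y"
  using partial_cmult[of g x y "-1"] assms by simp

lemma partial_diff:
  assumes "sm f" "sm g" "(x, y) \<in> S"
  shows "D (\<lambda>x y. f x y - g x y) x y = D f x y - D g x y"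
  using partial_add[of f "\<lambda>x y. - g x y" x y] assms by (simp add: partial_uminus)

lemma partial_sum:
  assumes "\<And>i. i \<in> I \<Longrightarrow> sm (f i)" "(x, y) \<in> S"
  shows "D (\<lambda>x y. \<Sum>i\<in>I. f i x y) x y = (\<Sum>i\<in>I. D (f i) x y)"
  using assms(1)
  by (induction I rule: infinite_finite_induct) (simp_all add: partial_const partial_add assms(2))

lemma sm_frechet: "sm f \<Longrightarrow> sm (\<lambda>x y. frechet_derivative (case_prod f) (at (x, y)) w)"
  using smooth_on_frechet[of S "case_prod f" w] by (simp add: sm_def case_prod_unfold)

lemma sm_partial: "sm f \<Longrightarrow> sm (D f)"
  by (subst sm_cong[OF partial_eq_frechet]) (simp_all add: sm_frechet)

end

lemma partial_partial:
  assumes "partial D" "partial D'" "sm f" "(x, y) \<in> S"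
  shows "D (D' f) x y =
    frechet_derivative (\<lambda>p. frechet_derivative (case_prod f) (at p) (direction D')) (at (x, y)) (direction D)"
proof -
  have "D (D' f) x y = D (\<lambda>x y. frechet_derivative (case_prod f) (at (x, y)) (direction D')) x y"
    by (rule partial_cong) (use assms in \<open>simp_all add: partial_eq_frechet[OF assms(2)] sm_partial\<close>)
  then show ?thesis
    using partial_eq_frechet[OF assms(1) sm_frechet assms(4)] assms by (simp add: case_prod_unfold)
qed

lemma partial_commute:
  assumes "partial D" "partial D'" "sm f" "(x, y) \<in> S"
  shows "D (D' f) x y = D' (D f) x y"
  using frechet_derivative_commute[OF open_S, of "case_prod f" "(x, y)"] assms
  by (simp add: partial_partial sm_def)

lemmas pd_simps = partial_add partial_mult partial_cmult partial_uminus partial_diff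
  partial_const partial_sum

lemmas sm_dx [simp] = sm_partial[OF partial_dx]
  and sm_dy [simp] = sm_partial[OF partial_dy]

lemma dy_coord: "dy k (\<lambda>x y. y $ i) x y = (if i = k then 1 else 0)"
proof -
  have "((\<lambda>t. (y + t *\<^sub>R axis k 1) $ i) has_real_derivative axis k 1 $ i) (at 0)"
    by (auto intro!: derivative_eq_intros)
  then show ?thesis unfolding dy_def by (simp add: DERIV_imp_deriv axis_def)
qed

lemma dx_coord: "dx k (\<lambda>x y. y $ i) x y = 0"
  by (simp add: dx_def)

end

context coordinate_domain
begin

lemmas dx_simps = pd_simps[OF partial_dx] and dy_simps = pd_simps[OF partial_dy]

lemma dx_dx: "sm f \<Longrightarrow> (x, y) \<in> S \<Longrightarrow> dx k (dx l f) x y = dx l (dx k f) x y"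
  by (rule partial_commute) auto

lemma dy_dx: "sm f \<Longrightarrow> (x, y) \<in> S \<Longrightarrow> dy k (dx l f) x y = dx l (dy k f) x y"
  by (rule partial_commute) auto

lemma dy_dy: "sm f \<Longrightarrow> (x, y) \<in> S \<Longrightarrow> dy k (dy l f) x y = dy l (dy k f) x y"
  by (rule partial_commute) auto

section \<open>Homogeneity in the fibre variable\<close>

definition euler :: "'n fld \<Rightarrow> 'n fld" where
  "euler f x y = (\<Sum>k\<in>UNIV. y $ k * dy k f x y)"

text \<open>Homogeneity is encoded infinitesimally, by Euler's relation and smoothness. In this form
  it passes to products and derivatives by algebra alone, without scaling arguments.\<close>

definition hom :: "real \<Rightarrow> 'n fld \<Rightarrow> bool" where
  "hom d f \<longleftrightarrow> sm f \<and> (\<forall>x y. (x, y) \<in> S \<longrightarrow> euler f x y = d * f x y)"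

lemma hom_sm: "hom d f \<Longrightarrow> sm f"
  by (simp add: hom_def)

lemma hom_euler: "hom d f \<Longrightarrow> (x, y) \<in> S \<Longrightarrow> (\<Sum>k\<in>UNIV. y $ k * dy k f x y) = d * f x y"
  by (simp add: hom_def euler_def)

lemma hom_coord: "hom 1 (\<lambda>x y. y $ i)"
  by (simp add: hom_def euler_def dy_coord)

lemma euler_mult:
  assumes "sm f" "sm g" "(x, y) \<in> S"
  shows "euler (\<lambda>x y. f x y * g x y) x y = f x y * euler g x y + euler f x y * g x y"
  using assms
  by (simp add: euler_def dy_simps sum_distrib_left sum_distrib_right algebra_simps flip: sum.distrib)

lemma euler_cmult: "sm g \<Longrightarrow> (x, y) \<in> S \<Longrightarrow> euler (\<lambda>x y. c * g x y) x y = c * euler g x y"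
  by (simp add: euler_def dy_simps sum_distrib_left algebra_simps)

lemma euler_add:
  assumes "sm f" "sm g" "(x, y) \<in> S"
  shows "euler (\<lambda>x y. f x y + g x y) x y = euler f x y + euler g x y"
  using assms by (simp add: euler_def dy_simps algebra_simps flip: sum.distrib)

lemma euler_sum:
  assumes "\<And>i. i \<in> I \<Longrightarrow> sm (f i)" "(x, y) \<in> S"
  shows "euler (\<lambda>x y. \<Sum>i\<in>I. f i x y) x y = (\<Sum>i\<in>I. euler (f i) x y)"
  using assms unfolding euler_def
  by (subst sum.swap) (simp add: dy_simps sum_distrib_left)

lemma hom_mult: "hom a f \<Longrightarrow> hom b g \<Longrightarrow> a + b = d \<Longrightarrow> hom d (\<lambda>x y. f x y * g x y)"
  by (auto simp: hom_def euler_mult algebra_simps)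

lemma hom_cmult: "hom a f \<Longrightarrow> hom a (\<lambda>x y. c * f x y)"
  by (auto simp: hom_def euler_cmult)

lemma hom_add: "hom a f \<Longrightarrow> hom a g \<Longrightarrow> hom a (\<lambda>x y. f x y + g x y)"
  by (auto simp: hom_def euler_add algebra_simps)

lemma hom_diff: "hom a f \<Longrightarrow> hom a g \<Longrightarrow> hom a (\<lambda>x y. f x y - g x y)"
  using hom_add[of a f "\<lambda>x y. (-1) * g x y"] hom_cmult[of a g "-1"] by simp

lemma hom_sum: "(\<And>i. i \<in> I \<Longrightarrow> hom a (f i)) \<Longrightarrow> hom a (\<lambda>x y. \<Sum>i\<in>I. f i x y)"
  by (auto simp: hom_def euler_sum sum_distrib_left)

lemma hom_dx:
  assumes "hom d f"
  shows "hom d (dx l f)"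
  unfolding hom_def euler_def
proof (intro conjI allI impI)
  show "sm (dx l f)" using assms by (simp add: hom_sm)
  fix x y assume xy: "(x, y) \<in> S"
  have "dx l (\<lambda>x y. \<Sum>k\<in>UNIV. y $ k * dy k f x y) x y = dx l (\<lambda>x y. d * f x y) x y"
    by (rule partial_cong) (use assms xy hom_euler[OF assms] in \<open>simp_all add: hom_sm\<close>)
  then show "(\<Sum>k\<in>UNIV. y $ k * dy k (dx l f) x y) = d * dx l f x y"
    using hom_sm[OF assms] xy by (simp add: dx_simps dx_coord dy_dx)
qed

text \<open>Differentiating Euler's relation also hits the coefficient \<open>y $ l\<close>; this
  extra \<open>dy l f\<close> lowers the degree by one. The equation \<open>d - 1 = e\<close> keeps
  degrees available as plain numerals.\<close>

lemma hom_dy: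
  assumes "hom d f" "d - 1 = e"
  shows "hom e (dy l f)"
  unfolding hom_def euler_def
proof (intro conjI allI impI)
  show "sm (dy l f)" using assms by (simp add: hom_sm)
  fix x y assume xy: "(x, y) \<in> S"
  have "dy l (\<lambda>x y. \<Sum>k\<in>UNIV. y $ k * dy k f x y) x y = dy l (\<lambda>x y. d * f x y) x y"
    by (rule partial_cong) (use assms xy hom_euler[OF assms(1)] in \<open>simp_all add: hom_sm\<close>)
  then have "(\<Sum>k\<in>UNIV. y $ k * dy l (dy k f) x y) + dy l f x y = d * dy l f x y"
    using hom_sm[OF assms(1)] xy by (simp add: dy_simps dy_coord sum.distrib)
  then have "(\<Sum>k\<in>UNIV. y $ k * dy k (dy l f) x y) + dy l f x y = d * dy l f x y"
    using hom_sm[OF assms(1)] xy by (simp add: dy_dy[of f x y l])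
  then show "(\<Sum>k\<in>UNIV. y $ k * dy k (dy l f) x y) = e * dy l f x y"
    using assms(2) by (auto simp: algebra_simps)
qed

end

section \<open>A Finsler metric in a chart\<close>

locale finsler_chart =
  fixes U :: "(real ^ 'n::finite) set" and L :: "'n fld"
  assumes open_U: "open U"
    and smooth_L: "smooth_on {(x, y). x \<in> U \<and> y \<noteq> 0} (case_prod L)"
    and homog_L: "\<And>x y t. x \<in> U \<Longrightarrow> y \<noteq> 0 \<Longrightarrow> t > 0 \<Longrightarrow> L x (t *\<^sub>R y) = t * L x y"
    and pos_def: "\<And>x y w. x \<in> U \<Longrightarrow> y \<noteq> 0 \<Longrightarrow> w \<noteq> 0 \<Longrightarrow>
      (\<Sum>i\<in>UNIV. \<Sum>j\<in>UNIV. g_mat L x y $ i $ j * w $ i * w $ j) > 0"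
begin

definition S :: "((real ^ 'n) \<times> (real ^ 'n)) set" where
  "S = {(x, y). x \<in> U \<and> y \<noteq> 0}"

lemma S_iff: "(x, y) \<in> S \<longleftrightarrow> x \<in> U \<and> y \<noteq> 0"
  by (simp add: S_def)

sublocale coordinate_domain S
proof
  have "S = U \<times> - {0}" by (auto simp: S_def)
  then show "open S" using open_U by (simp only: open_Times open_Compl closed_singleton)
qed

abbreviation "E \<equiv> sq L"
abbreviation "G \<equiv> spray L"

lemma sm_L [simp]: "sm L"
proof -
  have "smooth_on S (case_prod L)" unfolding S_def by (rule smooth_L)
  then show ?thesis by (simp only: sm_def)
qed

text \<open>The function t \<mapsto> \<open>E x (t *\<^sub>R y)\<close> is differentiated at t = 1
  in two ways, by the chain rule and as \<open>t\<^sup>2 * E x y\<close>.\<close>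

lemma hom_E: "hom 2 E"
  unfolding hom_def
proof (intro conjI allI impI)
  fix x y assume xy: "(x, y) \<in> S"
  let ?d = "frechet_derivative (case_prod E) (at (x, y))"
  have smE: "sm E" by simp
  note d = sm_has_derivative[OF smE xy]
  have "((\<lambda>t. (x, t *\<^sub>R y)) has_derivative (\<lambda>t. (0, t *\<^sub>R y))) (at 1)"
    by (auto intro!: derivative_eq_intros)
  from has_derivative_compose[OF this, of "case_prod E"] d
  have "((\<lambda>t. E x (t *\<^sub>R y)) has_derivative (\<lambda>t. ?d (0, t *\<^sub>R y))) (at 1)" by simp
  moreover have "((\<lambda>t. t\<^sup>2 * E x y) has_derivative (\<lambda>t. t * (2 * E x y))) (at 1)"
    by (auto intro!: derivative_eq_intros)
  then have "((\<lambda>t. E x (t *\<^sub>R y)) has_derivative (\<lambda>t. t * (2 * E x y))) (at 1)"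
    by (rule has_derivative_transform_within_open[of _ _ _ _ "{0<..}"])
      (use xy homog_L in \<open>auto simp: power_mult_distrib S_iff\<close>)
  ultimately have "(\<lambda>t. ?d (0, t *\<^sub>R y)) = (\<lambda>t. t * (2 * E x y))"
    by (rule has_derivative_unique)
  from fun_cong[OF this, of 1] have eq: "?d (0, y) = 2 * E x y" by simp
  show "euler E x y = 2 * E x y"
    using eq frechet_eq_dx_dy[OF smE xy, of 0 y] by (simp add: euler_def)
qed simp

lemma sm_g [simp]: "sm (\<lambda>x y. g_mat L x y $ i $ j)"
  using sm_mult[OF sm_const[of "1/2"], of "dy i (dy j E)"] by (simp add: g_mat_def)

lemma g_sym: "(x, y) \<in> S \<Longrightarrow> g_mat L x y $ i $ j = g_mat L x y $ j $ i"
  using dy_dy[of E x y i j] by (simp add: g_mat_def)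

text \<open>\<open>dy k E\<close> has degree 1, so contracting the Hessian of \<open>E\<close> with
  \<open>y\<close> returns \<open>dy k E\<close>; the division by 2 is the 1/2 in
  \<open>g_mat\<close>.\<close>

lemma y_low_eq: "(x, y) \<in> S \<Longrightarrow> y_low L k x y = dy k E x y / 2"
  using hom_euler[OF hom_dy[OF hom_E], of 1 x y k] dy_dy[of E x y k]
  by (simp add: y_low_def g_mat_def mult.commute flip: sum_divide_distrib)

text \<open>Euler's relation, used for \<open>dy k E\<close> and for \<open>E\<close>, identifies
  \<open>E\<close> with the metric evaluated on \<open>y\<close> twice. Division by \<open>E\<close>
  is thus possible on all of \<open>S\<close>.\<close>

lemma E_pos:
  assumes "(x, y) \<in> S"
  shows "E x y > 0"
proof -
  have "(\<Sum>i\<in>UNIV. \<Sum>j\<in>UNIV. g_mat L x y $ i $ j * y $ i * y $ j) = (\<Sum>i\<in>UNIV. y $ i * y_low L i x y)"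
    by (simp add: y_low_def sum_distrib_left mult_ac)
  also have "\<dots> = E x y"
    using hom_euler[OF hom_E assms] by (simp add: y_low_eq[OF assms] flip: sum_divide_distrib)
  finally show ?thesis using pos_def[of x y y] assms by (simp add: S_iff)
qed

lemma g_ker:
  assumes "(x, y) \<in> S" "g_mat L x y *v w = 0"
  shows "w = 0"
proof (rule ccontr)
  assume "w \<noteq> 0"
  have "(\<Sum>i\<in>UNIV. \<Sum>j\<in>UNIV. g_mat L x y $ i $ j * w $ i * w $ j) = (\<Sum>i\<in>UNIV. w $ i * (g_mat L x y *v w) $ i)"
    by (simp add: matrix_vector_mult_def sum_distrib_left mult_ac)
  then show False using pos_def[of x y w] assms \<open>w \<noteq> 0\<close> by (simp add: S_iff)
qed

lemma g_invertible: "(x, y) \<in> S \<Longrightarrow> invertible (g_mat L x y)"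
  using g_ker matrix_left_invertible_ker[of "g_mat L x y"] invertible_left_inverse by blast

lemma g_inv_right: "(x, y) \<in> S \<Longrightarrow> g_mat L x y ** g_inv L x y = mat 1"
  using someI_ex[of "\<lambda>A'. g_mat L x y ** A' = mat 1 \<and> A' ** g_mat L x y = mat 1"] g_invertible
  unfolding g_inv_def matrix_inv_def invertible_def by blast

section \<open>Regularity of the spray coefficients\<close>

definition "P l x y = (\<Sum>k\<in>UNIV. dx k (dy l E) x y * y $ k) - dx l E x y"

lemma sm_P [simp]: "sm (P l)"
  unfolding P_def by simp

text \<open>\<open>P\<close> is four times the spray with its index lowered. This equation replaces
  the definition by the inverse matrix: both of its known coefficients, the metric and
  \<open>P\<close>, are plain derivatives of \<open>E\<close>.\<close>

lemma g_spray:
  assumes "(x, y) \<in> S"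
  shows "g_mat L x y *v (\<chi> i. G i x y) = (\<chi> l. P l x y / 4)"
proof -
  have "(\<chi> i. G i x y) = g_inv L x y *v (\<chi> l. P l x y / 4)"
    by (simp add: vec_eq_iff spray_def matrix_vector_mult_def P_def sum_distrib_left mult_ac)
  then show ?thesis
    using g_inv_right[OF assms] by (simp add: matrix_vector_mul_assoc)
qed

text \<open>Cramer's rule for \<open>g_spray\<close> writes \<open>G i\<close> as a quotient of
  determinants with smooth entries and nonvanishing denominator.\<close>

lemma sm_G [simp]: "sm (G i)"
proof -
  \<comment> \<open>The numerator matrix of Cramer's rule: column \<open>i\<close> of the metric is
    replaced by the right-hand side.\<close>
  define M where "M = (\<lambda>x y. (\<chi> a b. if b = i then P a x y / 4 else g_mat L x y $ a $ b))"
  have "det (g_mat L x y) \<noteq> 0" if "(x, y) \<in> S" for x y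
    using g_invertible[OF that] by (simp add: invertible_det_nz)
  moreover have "sm (\<lambda>x y. M x y $ a $ b)" for a b
    using sm_mult[OF sm_P[of a] sm_const[of "1/4"]] by (cases "b = i") (simp_all add: M_def)
  ultimately have "sm (\<lambda>x y. det (M x y) / det (g_mat L x y))"
    by (intro sm_divide sm_det) auto
  moreover have "G i x y = det (M x y) / det (g_mat L x y)" if "(x, y) \<in> S" for x y
    using cramer[THEN iffD1, OF _ g_spray[OF that]] g_invertible[OF that]
    by (simp add: invertible_det_nz M_def vec_eq_iff cong: if_cong)
  ultimately show ?thesis by (subst sm_cong)
qed

lemma g_spray_sum:
  assumes "(x, y) \<in> S"
  shows "2 * (\<Sum>i\<in>UNIV. G i x y * dy l (dy i E) x y) = (\<Sum>k\<in>UNIV. y $ k * dx k (dy l E) x y) - dx l E x y"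
proof -
  have "(\<Sum>i\<in>UNIV. g_mat L x y $ l $ i * G i x y) = P l x y / 4"
    using arg_cong[OF g_spray[OF assms], of "\<lambda>v. v $ l"] by (simp add: matrix_vector_mult_def)
  moreover have "(\<Sum>i\<in>UNIV. G i x y * dy l (dy i E) x y) = 2 * (\<Sum>i\<in>UNIV. g_mat L x y $ l $ i * G i x y)"
    by (simp add: sum_distrib_left g_mat_def mult_ac)
  ultimately show ?thesis by (simp add: P_def mult_ac)
qed

lemma hom_P: "hom 2 (P l)"
  unfolding P_def by (intro hom_diff hom_sum hom_mult[where a = 1 and b = 1] hom_dx hom_dy[OF hom_E] hom_coord hom_E) auto

lemma hom_g: "hom 0 (\<lambda>x y. g_mat L x y $ i $ j)"
  unfolding g_mat_def using hom_cmult[OF hom_dy[OF hom_dy[OF hom_E refl]], of 0 "1/2" i j] by simp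

text \<open>The Euler operator is applied to \<open>g_spray\<close>, where the metric has degree 0
  and \<open>P\<close> degree 2. The defect \<open>euler (G i) - 2 * G i\<close> is then in the
  kernel of the metric, so the inverse matrix is never differentiated.\<close>

lemma hom_G: "hom 2 (G i)"
  unfolding hom_def
proof (intro conjI allI impI)
  fix x y assume xy: "(x, y) \<in> S"
  have eq: "(\<Sum>i\<in>UNIV. g_mat L x y $ l $ i * G i x y) = 1/4 * P l x y" if "(x, y) \<in> S" for l x y
    using arg_cong[OF g_spray[OF that], of "\<lambda>v. v $ l"] by (simp add: matrix_vector_mult_def)
  have "dy k (\<lambda>x y. \<Sum>i\<in>UNIV. g_mat L x y $ l $ i * G i x y) x y = dy k (\<lambda>x y. 1/4 * P l x y) x y" for k l
    by (rule partial_cong[OF partial_dy eq _ xy]) simp_all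
  then have "euler (\<lambda>x y. \<Sum>i\<in>UNIV. g_mat L x y $ l $ i * G i x y) x y = euler (\<lambda>x y. 1/4 * P l x y) x y" for l
    unfolding euler_def by simp
  then have "(\<Sum>i\<in>UNIV. g_mat L x y $ l $ i * euler (G i) x y) = 1/4 * euler (P l) x y" for l
    using xy hom_g euler_cmult[of "P l" x y "1/4" for l] by (simp add: euler_sum euler_mult hom_def)
  note eu = this
  have "(\<Sum>i\<in>UNIV. g_mat L x y $ l $ i * (euler (G i) x y - 2 * G i x y)) = 0" for l
  proof -
    have "euler (P l) x y = 2 * P l x y" using hom_P xy by (simp add: hom_def)
    then have "(\<Sum>i\<in>UNIV. g_mat L x y $ l $ i * euler (G i) x y) = 2 * (\<Sum>i\<in>UNIV. g_mat L x y $ l $ i * G i x y)"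
      using eu[of l] eq[OF xy, of l] by simp
    then show ?thesis
      by (simp add: right_diff_distrib sum_subtractf mult.left_commute[of _ 2] flip: sum_distrib_left)
  qed
  then have "g_mat L x y *v (\<chi> i. euler (G i) x y - 2 * G i x y) = 0"
    by (simp add: matrix_vector_mult_def vec_eq_iff)
  from g_ker[OF xy this] show "euler (G i) x y = 2 * G i x y"
    by (simp add: vec_eq_iff)
qed simp

text \<open>Contracting \<open>g_spray_sum\<close> with \<open>y\<close> and applying Euler's
  relation shows that \<open>E\<close> is constant along its own geodesic spray.\<close>

lemma spray_E:
  assumes "(x, y) \<in> S"
  shows "2 * (\<Sum>i\<in>UNIV. G i x y * dy i E x y) = (\<Sum>k\<in>UNIV. y $ k * dx k E x y)"
proof -
  have e: "(\<Sum>l\<in>UNIV. y $ l * dy l (dy i E) x y) = dy i E x y" for i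
    using hom_euler[OF hom_dy[OF hom_E], of 1 x y i] assms by simp
  have "(\<Sum>l\<in>UNIV. y $ l * (2 * (\<Sum>i\<in>UNIV. G i x y * dy l (dy i E) x y)))
      = 2 * (\<Sum>i\<in>UNIV. G i x y * (\<Sum>l\<in>UNIV. y $ l * dy l (dy i E) x y))"
    by (simp add: sum_distrib_left mult_ac) (rule sum.swap)
  then have 1: "(\<Sum>l\<in>UNIV. y $ l * (2 * (\<Sum>i\<in>UNIV. G i x y * dy l (dy i E) x y)))
      = 2 * (\<Sum>i\<in>UNIV. G i x y * dy i E x y)" by (simp add: e)
  have f: "(\<Sum>l\<in>UNIV. y $ l * dx k (dy l E) x y) = 2 * dx k E x y" for k
    using hom_euler[OF hom_dx[OF hom_E], of x y k] assms by (simp add: dy_dx)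
  have "(\<Sum>l\<in>UNIV. y $ l * (\<Sum>k\<in>UNIV. y $ k * dx k (dy l E) x y))
      = (\<Sum>k\<in>UNIV. y $ k * (\<Sum>l\<in>UNIV. y $ l * dx k (dy l E) x y))"
    by (simp add: sum_distrib_left) (subst sum.swap, simp add: mult_ac)
  then have 2: "(\<Sum>l\<in>UNIV. y $ l * ((\<Sum>k\<in>UNIV. y $ k * dx k (dy l E) x y) - dx l E x y))
      = (\<Sum>k\<in>UNIV. y $ k * dx k E x y)"
    by (simp add: f right_diff_distrib sum_subtractf mult.left_commute[of _ 2] flip: sum_distrib_left)
  show ?thesis
    using 1 2 by (simp add: g_spray_sum[OF assms])
qed

text \<open>The \<open>y\<close>-derivative of \<open>spray_E\<close> minus
  \<open>g_spray_sum\<close> is, up to the factor 2, exactly this horizontal derivative.\<close>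

lemma delta_E:
  assumes "(x, y) \<in> S"
  shows "delta L m E x y = 0"
proof -
  have "dy m (\<lambda>x y. 2 * (\<Sum>i\<in>UNIV. G i x y * dy i E x y)) x y = dy m (\<lambda>x y. \<Sum>k\<in>UNIV. y $ k * dx k E x y) x y"
    by (rule partial_cong) (use assms spray_E in simp_all)
  then have "2 * ((\<Sum>i\<in>UNIV. G i x y * dy m (dy i E) x y) + (\<Sum>i\<in>UNIV. dy m (G i) x y * dy i E x y))
     = (\<Sum>k\<in>UNIV. y $ k * dx k (dy m E) x y) + dx m E x y"
    using assms by (simp add: dy_simps dy_coord dy_dx sum.distrib)
  with g_spray_sum[OF assms, of m] show ?thesis
    by (simp add: delta_def spray1_def)
qed

end

section \<open>Curvature of the spray and of Berwald's connection\<close>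

context finsler_chart
begin

text \<open>\<open>Sp\<close> is the spray as a vector field on the slit tangent bundle, the part of the horizontal
  derivative along \<open>y\<close> that does not involve the connection coefficients.\<close>

definition Sp :: "'n fld \<Rightarrow> 'n fld" where
  "Sp f = (\<lambda>x y. (\<Sum>j\<in>UNIV. y $ j * dx j f x y) - 2 * (\<Sum>j\<in>UNIV. G j x y * dy j f x y))"

lemma sm_Sp [simp]: "sm f \<Longrightarrow> sm (Sp f)"
  unfolding Sp_def by simp

lemma Sp_cong:
  assumes "\<And>x y. (x, y) \<in> S \<Longrightarrow> f x y = g x y" "sm f" "(x, y) \<in> S"
  shows "Sp f x y = Sp g x y"
  unfolding Sp_def using partial_cong[OF partial_dx assms] partial_cong[OF partial_dy assms] by simp

lemma Sp_add:
  "sm f \<Longrightarrow> sm g \<Longrightarrow> (x, y) \<in> S \<Longrightarrow> Sp (\<lambda>x y. f x y + g x y) x y = Sp f x y + Sp g x y"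
  unfolding Sp_def by (simp add: dx_simps dy_simps algebra_simps sum.distrib)

lemma Sp_mult_coord:
  assumes "sm f" "(x, y) \<in> S"
  shows "Sp (\<lambda>x y. f x y * y $ i) x y = Sp f x y * y $ i - 2 * f x y * G i x y"
  unfolding Sp_def using assms
  by (simp add: dx_simps dy_simps dx_coord dy_coord ring_distribs sum.distrib sum_distrib_right
      flip: mult.assoc)

lemma dy_Sp:
  assumes "sm f" "(x, y) \<in> S"
  shows "dy l (Sp f) x y = Sp (dy l f) x y + dx l f x y - 2 * (\<Sum>r\<in>UNIV. dy l (G r) x y * dy r f x y)"
  unfolding Sp_def using assms
  by (simp add: dy_simps dy_coord dy_dx dy_dy[of f x y l] sum.distrib)

lemma riemann_eq:
  "riemann L i k = (\<lambda>x y. 2 * dx k (G i) x y - Sp (dy k (G i)) x y - (\<Sum>j\<in>UNIV. dy j (G i) x y * dy k (G j) x y))"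
  unfolding riemann_def Sp_def by (intro ext) simp

lemma sm_riemann [simp]: "sm (riemann L i k)"
  unfolding riemann_eq by simp

lemma hom_Sp: "hom d f \<Longrightarrow> d + 1 = e \<Longrightarrow> hom e (Sp f)"
  unfolding Sp_def
  by (intro hom_diff hom_sum hom_cmult hom_mult[OF hom_coord hom_dx] hom_mult[OF hom_G hom_dy]) auto

lemma hom_riemann: "hom 2 (riemann L i k)"
  unfolding riemann_eq
  by (intro hom_diff hom_sum hom_cmult hom_dx hom_G hom_Sp hom_mult[OF hom_dy[OF hom_G] hom_dy[OF hom_G]] hom_dy[OF hom_G]) auto

lemma dy_riemann:
  assumes "(x, y) \<in> S"
  shows "dy l (riemann L i k) x y = 2 * dx k (dy l (G i)) x y
    - Sp (dy l (dy k (G i))) x y - dx l (dy k (G i)) x y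
    + 2 * (\<Sum>r\<in>UNIV. dy l (G r) x y * dy r (dy k (G i)) x y)
    - (\<Sum>j\<in>UNIV. dy j (G i) x y * dy l (dy k (G j)) x y)
    - (\<Sum>j\<in>UNIV. dy l (dy j (G i)) x y * dy k (G j) x y)"
  unfolding riemann_eq using assms
  by (simp add: dy_simps dy_dx dy_Sp sum.distrib)

lemma dy_dy_riemann:
  assumes "(x, y) \<in> S"
  shows "dy m (dy l (riemann L i k)) x y = 2 * dx k (dy m (dy l (G i))) x y
    - Sp (dy m (dy l (dy k (G i)))) x y - dx m (dy l (dy k (G i))) x y
    + 2 * (\<Sum>r\<in>UNIV. dy m (G r) x y * dy r (dy l (dy k (G i))) x y)
    - dx l (dy m (dy k (G i))) x y
    + 2 * (\<Sum>r\<in>UNIV. dy l (G r) x y * dy m (dy r (dy k (G i))) x y)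
    + 2 * (\<Sum>r\<in>UNIV. dy m (dy l (G r)) x y * dy r (dy k (G i)) x y)
    - (\<Sum>j\<in>UNIV. dy j (G i) x y * dy m (dy l (dy k (G j))) x y)
    - (\<Sum>j\<in>UNIV. dy m (dy j (G i)) x y * dy l (dy k (G j)) x y)
    - (\<Sum>j\<in>UNIV. dy l (dy j (G i)) x y * dy m (dy k (G j)) x y)
    - (\<Sum>j\<in>UNIV. dy m (dy l (dy j (G i))) x y * dy k (G j) x y)"
  by (subst partial_cong[OF partial_dy dy_riemann _ assms])
    (use assms in \<open>simp_all add: dy_simps dy_dx dy_Sp sum.distrib\<close>)

lemma dy_dy_cong:
  "sm f \<Longrightarrow> (x, y) \<in> S \<Longrightarrow> dy a (dy b (dy c f)) x y = dy a (dy c (dy b f)) x y"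
  by (rule partial_cong[OF partial_dy dy_dy]) auto

text \<open>Under the cyclic sum the \<open>x\<close>-derivatives cancel as 2 - 1 - 1, and so do the
  products of two second derivatives of the spray. The third-order \<open>Sp\<close> terms add up
  with weight -3, and each contraction with a lower index collects 2 + 2 - 1 = 3.\<close>

lemma cyclic_riemann:
  assumes "(x, y) \<in> S"
  shows "dy m (dy l (riemann L i k)) x y + dy k (dy m (riemann L i l)) x y + dy l (dy k (riemann L i m)) x y
   = - 3 * (Sp (dy k (dy l (dy m (G i)))) x y
     + (\<Sum>r\<in>UNIV. dy k (dy l (dy m (G r))) x y * dy r (G i) x y)
     - (\<Sum>r\<in>UNIV. dy r (dy l (dy m (G i))) x y * dy k (G r) x y)
     - (\<Sum>r\<in>UNIV. dy k (dy r (dy m (G i))) x y * dy l (G r) x y)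
     - (\<Sum>r\<in>UNIV. dy k (dy l (dy r (G i))) x y * dy m (G r) x y))"
proof -
  \<comment> \<open>\<open>N\<close>, \<open>C\<close>, \<open>B\<close> are the first, second and
    third \<open>y\<close>-derivatives of the spray, upper index in front. Only three kinds of sums
    occur: \<open>T\<close> contracts \<open>N\<close> with a lower index of \<open>B\<close>,
    \<open>Q\<close> contracts two factors \<open>C\<close>, and \<open>U\<close> contracts
    \<open>N\<close> with the upper index of \<open>B\<close>. Bringing their indices into a normal
    order reduces the claim to linear cancellation.\<close>
  define B where "B a b c d = dy b (dy c (dy d (G a))) x y" for a b c d
  define N where "N a b = dy b (G a) x y" for a b
  define C where "C a b c = dy b (dy c (G a)) x y" for a b c
  have B: "B a b c d = B a c b d" "B a b c d = B a b d c" for a b c d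
    unfolding B_def using assms by (auto intro: dy_dy dy_dy_cong)
  have C: "C a b c = C a c b" for a b c
    unfolding C_def using assms by (auto intro: dy_dy)
  have X: "dx a (dy b (dy c (G i))) x y = dx a (dy c (dy b (G i))) x y" for a b c
    by (rule partial_cong[OF partial_dx dy_dy]) (use assms in auto)
  have Y: "Sp (dy m (dy l (dy k (G i)))) x y = Sp (dy k (dy l (dy m (G i)))) x y"
          "Sp (dy k (dy m (dy l (G i)))) x y = Sp (dy k (dy l (dy m (G i)))) x y"
          "Sp (dy l (dy k (dy m (G i)))) x y = Sp (dy k (dy l (dy m (G i)))) x y"
    using dy_dy_cong dy_dy assms by (auto intro!: Sp_cong)
  define T where "T a b c = (\<Sum>r\<in>UNIV. N r a * B i r b c)" for a b c
  have T1: "(\<Sum>r\<in>UNIV. N r a * B i r b c) = T a b c" and T2: "(\<Sum>r\<in>UNIV. N r a * B i b r c) = T a b c"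
    and T3: "(\<Sum>r\<in>UNIV. N r a * B i b c r) = T a b c" for a b c
    using B by (simp_all add: T_def)
  have T4: "(\<Sum>r\<in>UNIV. B i r b c * N r a) = T a b c" and T5: "(\<Sum>r\<in>UNIV. B i b r c * N r a) = T a b c"
    and T6: "(\<Sum>r\<in>UNIV. B i b c r * N r a) = T a b c" for a b c
    using T1 T2 T3 by (simp_all add: mult.commute)
  have Tsym: "T m l k = T m k l" "T l m k = T l k m" "T k m l = T k l m"
    unfolding T_def using B(2) by simp_all
  define Q where "Q a b c = (\<Sum>r\<in>UNIV. C i r a * C r b c)" for a b c
  have Q1: "(\<Sum>r\<in>UNIV. C r b c * C i r a) = Q a b c" and Q2: "(\<Sum>r\<in>UNIV. C i a r * C r b c) = Q a b c"
    for a b c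
    using C[of i a] by (simp_all add: Q_def mult.commute)
  have Qsym: "Q m l k = Q m k l" "Q l m k = Q l k m" "Q k m l = Q k l m"
    unfolding Q_def using C by simp_all
  define U where "U = (\<Sum>r\<in>UNIV. N i r * B r k l m)"
  have "B r m l k = B r k l m" "B r k m l = B r k l m" "B r l k m = B r k l m" for r
    using B by metis+
  then have U: "(\<Sum>r\<in>UNIV. N i r * B r m l k) = U" "(\<Sum>r\<in>UNIV. N i r * B r k m l) = U"
      "(\<Sum>r\<in>UNIV. N i r * B r l k m) = U" "(\<Sum>r\<in>UNIV. B r k l m * N i r) = U"
    by (simp_all add: U_def mult.commute)
  show ?thesis
    unfolding dy_dy_riemann[OF assms] Y X[of _ m l] X[of _ k m] X[of _ l k]
    unfolding B_def[symmetric] C_def[symmetric] N_def[symmetric]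
    by (simp only: T1 T2 T3 T4 T5 T6 Tsym Q1 Q2 Qsym U) (simp add: algebra_simps)
qed

text \<open>By homogeneity of the spray, contracting the connection coefficients with
  \<open>y\<close> turns second derivatives of \<open>G\<close> into first ones and first ones into
  \<open>2 * G\<close>. The derivative terms assemble to \<open>Sp\<close>.\<close>

lemma hcov_y:
  assumes "\<And>j i k l. sm (T j i k l)" "(x, y) \<in> S"
  shows "(\<Sum>m\<in>UNIV. hcov L T j i k l m x y * y $ m) = Sp (T j i k l) x y
     + (\<Sum>r\<in>UNIV. T j r k l x y * dy r (G i) x y)
     - (\<Sum>r\<in>UNIV. T r i k l x y * dy j (G r) x y)
     - (\<Sum>r\<in>UNIV. T j i r l x y * dy k (G r) x y)
     - (\<Sum>r\<in>UNIV. T j i k r x y * dy l (G r) x y)"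
proof -
  have G: "(\<Sum>m\<in>UNIV. dy m (G r) x y * y $ m) = 2 * G r x y" for r
    using hom_euler[OF hom_G assms(2)] by (simp add: mult.commute)
  have G1: "(\<Sum>m\<in>UNIV. dy r (dy m (G i)) x y * y $ m) = dy r (G i) x y" for r i
    using hom_euler[OF hom_dy[OF hom_G], of 1 x y r i] assms(2) by (simp add: mult.commute dy_dy[of _ x y r])
  have sw: "(\<Sum>m\<in>UNIV. (\<Sum>r\<in>UNIV. a r * b r m) * y $ m) = (\<Sum>r\<in>UNIV. a r * (\<Sum>m\<in>UNIV. b r m * y $ m))"
    for a and b :: "'n \<Rightarrow> 'n \<Rightarrow> real"
    by (simp add: sum_distrib_left sum_distrib_right mult_ac) (subst sum.swap, simp)
  have N: "(\<Sum>m\<in>UNIV. (\<Sum>r\<in>UNIV. dy m (G r) x y * dy r f x y) * y $ m) = 2 * (\<Sum>r\<in>UNIV. G r x y * dy r f x y)" for f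
  proof -
    have "(\<Sum>m\<in>UNIV. (\<Sum>r\<in>UNIV. dy m (G r) x y * dy r f x y) * y $ m)
        = (\<Sum>m\<in>UNIV. (\<Sum>r\<in>UNIV. dy r f x y * dy m (G r) x y) * y $ m)"
      by (simp add: mult.commute)
    then show ?thesis by (simp only: sw G) (simp add: sum_distrib_left mult_ac)
  qed
  show ?thesis
    unfolding hcov_def delta_def spray1_def spray2_def ring_distribs sum.distrib left_diff_distrib sum_subtractf sw N G1
    by (simp add: Sp_def mult.commute)
qed

lemma cyclic_riemann_GBW:
  assumes \<beta>: "\<And>j i k l. sm (\<beta> j i k l)" and b: "\<And>j k l. sm (b j k l)"
    and B: "\<And>x y j i k l. (x, y) \<in> S \<Longrightarrow> berwald L j i k l x y = \<beta> j i k l x y + b j k l x y * y $ i"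
    and \<beta>0: "\<And>x y j i k l. (x, y) \<in> S \<Longrightarrow> (\<Sum>m\<in>UNIV. hcov L \<beta> j i k l m x y * y $ m) = 0"
    and xy: "(x, y) \<in> S"
  shows "\<exists>\<tau>. \<forall>i. dy m (dy l (riemann L i k)) x y + dy k (dy m (riemann L i l)) x y
    + dy l (dy k (riemann L i m)) x y = \<tau> * y $ i"
proof -
  \<comment> \<open>The multiplier is -3 times the covariant derivative of \<open>b\<close> along
    \<open>y\<close>.\<close>
  define \<tau> where "\<tau> = - 3 * (Sp (b k l m) x y - (\<Sum>r\<in>UNIV. b r l m x y * dy k (G r) x y)
    - (\<Sum>r\<in>UNIV. b k r m x y * dy l (G r) x y) - (\<Sum>r\<in>UNIV. b k l r x y * dy m (G r) x y))"
  have "dy m (dy l (riemann L i k)) x y + dy k (dy m (riemann L i l)) x y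
    + dy l (dy k (riemann L i m)) x y = \<tau> * y $ i" for i
  proof -
    have B': "dy j (dy k (dy l (G i))) x y = \<beta> j i k l x y + b j k l x y * y $ i" for i j k l
      using B[OF xy] by (simp add: berwald_def)
    have SpB: "Sp (dy k (dy l (dy m (G i)))) x y = Sp (\<beta> k i l m) x y + (Sp (b k l m) x y * y $ i - 2 * b k l m x y * G i x y)"
    proof -
      have "Sp (dy k (dy l (dy m (G i)))) x y = Sp (\<lambda>x y. \<beta> k i l m x y + b k l m x y * y $ i) x y"
        by (rule Sp_cong) (use B xy in \<open>simp_all add: berwald_def\<close>)
      then show ?thesis using \<beta> b xy by (simp add: Sp_add Sp_mult_coord)
    qed
    \<comment> \<open>This cancels the term \<open>- 2 * b k l m * G i\<close> in
      \<open>SpB\<close>, leaving only multiples of \<open>y $ i\<close>.\<close>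
    have e: "(\<Sum>r\<in>UNIV. b k l m x y * y $ r * dy r (G i) x y) = 2 * b k l m x y * G i x y"
      using hom_euler[OF hom_G xy, of i] by (simp add: mult.assoc flip: sum_distrib_left)
    have f: "(\<Sum>r\<in>UNIV. c r * y $ i * d r) = (\<Sum>r\<in>UNIV. c r * d r) * y $ i" for c d :: "'n \<Rightarrow> real"
      by (simp add: sum_distrib_left sum_distrib_right mult_ac)
    show ?thesis
      using \<beta>0[OF xy, of k i l m] unfolding hcov_y[OF \<beta> xy]
      unfolding cyclic_riemann[OF xy] B' SpB ring_distribs sum.distrib e f \<tau>_def
      by (simp add: algebra_simps)
  qed
  then show ?thesis by blast
qed

end

section \<open>Scalar flag curvature\<close>

lemma ex_index_notin:
  fixes X :: "'n::finite set"
  assumes "card X < CARD('n)"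
  shows "\<exists>i. i \<notin> X"
  using assms by (metis UNIV_eq_I less_irrefl)

lemma kronecker_symmetrization_eq_0:
  fixes A :: "'n::finite \<Rightarrow> 'n \<Rightarrow> real" and y :: "real ^ 'n"
  assumes "CARD('n) \<ge> 2" "y \<noteq> 0" and sym: "\<And>a b. A a b = A b a"
    and eq: "\<And>i k l m. (if i = k then 1 else 0) * A l m + (if i = l then 1 else 0) * A k m
        + (if i = m then 1 else 0) * A k l = \<tau> k l m * y $ i"
  shows "A a b = 0"
proof -
  \<comment> \<open>Contracting \<open>i\<close> with a covector \<open>w\<close> that annihilates \<open>y\<close> removes the right-hand side.\<close>
  obtain p where p: "y $ p \<noteq> 0" using assms(2) by (auto simp: vec_eq_iff)
  have "\<exists>q. q \<noteq> p"
    using ex_index_notin[of "{p}"] assms(1) by auto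
  then obtain q where q: "q \<noteq> p" by blast
  define w where "w i = (if i = q then y $ p else if i = p then - y $ q else 0)" for i
  have wq: "w q \<noteq> 0" using p by (simp add: w_def)
  have w: "w k * A l m + w l * A k m + w m * A k l = 0" for k l m
  proof -
    have wk: "w k = y $ p * (if q = k then 1 else 0) - y $ q * (if p = k then 1 else 0)" for k
      using q by (auto simp: w_def)
    have "w k * A l m + w l * A k m + w m * A k l =
       y $ p * ((if q = k then 1 else 0) * A l m + (if q = l then 1 else 0) * A k m + (if q = m then 1 else 0) * A k l)
     - y $ q * ((if p = k then 1 else 0) * A l m + (if p = l then 1 else 0) * A k m + (if p = m then 1 else 0) * A k l)"
      unfolding wk by (simp only: ring_distribs mult.assoc)
    then show ?thesis unfolding eq by simp
  qed
  \<comment> \<open>The index \<open>q\<close> is inserted three times, twice and once. Each round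
    leaves a nonzero multiple of the wanted entry and entries already known to vanish.\<close>
  have qq: "A q q = 0" using w[of q q q] wq by simp
  have qm: "A q m = 0" for m using w[of q q m] wq qq by simp
  show ?thesis using w[of q a b] wq qm by simp
qed

context coordinate_domain
begin

text \<open>From dimension 2 on, a fibre without its origin is connected, so a vanishing derivative
  forces a single value.\<close>

lemma dy_constant:
  assumes "sm f" "CARD('n) \<ge> 2" "\<And>y. y \<noteq> 0 \<Longrightarrow> (x, y) \<in> S"
    and "\<And>k y. y \<noteq> 0 \<Longrightarrow> dy k f x y = 0" "y \<noteq> 0" "y' \<noteq> 0"
  shows "f x y = f x y'"
proof (rule has_derivative_zero_unique_connected[of "- {0}" "f x"])
  show "connected (- {0 :: real ^ 'n})" using assms(2) by (intro connected_punctured_universe) simp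
  fix z :: "real ^ 'n" assume "z \<in> - {0}"
  then have z: "z \<noteq> 0" and S: "(x, z) \<in> S" using assms(3) by simp_all
  have "((\<lambda>y. (x, y)) has_derivative (\<lambda>v. (0, v))) (at z)"
    by (auto intro!: derivative_eq_intros)
  from has_derivative_compose[OF this, of "case_prod f"] sm_has_derivative[OF assms(1) S]
  have "((\<lambda>y. f x y) has_derivative (\<lambda>v. frechet_derivative (case_prod f) (at (x, z)) (0, v))) (at z)"
    by simp
  then show "(f x has_derivative (\<lambda>v. 0)) (at z)"
    using frechet_eq_dx_dy[OF assms(1) S] assms(4)[OF z] by simp
qed (use assms in auto)

lemma locally_constant:
  assumes "sm f" "CARD('n) \<ge> 2" "open B" "connected B" "B \<times> - {0} \<subseteq> S"
    and "\<And>k x y. x \<in> B \<Longrightarrow> y \<noteq> 0 \<Longrightarrow> dx k f x y = 0" "\<And>k x y. x \<in> B \<Longrightarrow> y \<noteq> 0 \<Longrightarrow> dy k f x y = 0"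
    and "x \<in> B" "x' \<in> B" "y \<noteq> 0" "y' \<noteq> 0"
  shows "f x y = f x' y'"
proof -
  have "case_prod f (x, y) = case_prod f (x', y')"
  proof (rule has_derivative_zero_unique_connected[of "B \<times> - {0}"])
    show "connected (B \<times> - {0 :: real ^ 'n})"
      using assms(2,4) by (intro connected_Times connected_punctured_universe) simp_all
    show "open (B \<times> - {0 :: real ^ 'n})" using assms(3) by (simp only: open_Times open_Compl closed_singleton)
    fix p assume p: "p \<in> B \<times> - {0 :: real ^ 'n}"
    obtain a b where ab: "p = (a, b)" by fastforce
    have S: "(a, b) \<in> S" using p ab assms(5) by blast
    have "frechet_derivative (case_prod f) (at (a, b)) = (\<lambda>_. 0)"
      using frechet_eq_dx_dy[OF assms(1) S] assms(6,7) p ab by (auto simp: fun_eq_iff)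
    then show "(case_prod f has_derivative (\<lambda>v. 0)) (at p)"
      using sm_has_derivative[OF assms(1) S] ab by simp
  qed (use assms in auto)
  then show ?thesis by simp
qed

end

locale scalar_curvature_chart = finsler_chart U L
  for U :: "(real ^ 'n::finite) set" and L +
  fixes lam :: "'n fld"
  assumes dim: "CARD('n) > 2"
    and scalar: "\<And>x y i k. x \<in> U \<Longrightarrow> y \<noteq> 0 \<Longrightarrow> riemann L i k x y =
      lam x y * ((L x y)\<^sup>2 * (if i = k then 1 else 0) - y $ i * y_low L k x y)"
begin

lemma riemann_scalar:
  "(x, y) \<in> S \<Longrightarrow> riemann L i k x y =
    lam x y * E x y * (if i = k then 1 else 0) - y $ i * (1/2 * (lam x y * dy k E x y))"
  using scalar[of x y i k] by (simp add: S_iff y_low_eq algebra_simps)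

lemma trace_riemann:
  assumes "(x, y) \<in> S"
  shows "(\<Sum>i\<in>UNIV. riemann L i i x y) = (CARD('n) - 1) * (lam x y * E x y)"
proof -
  have "(\<Sum>i\<in>UNIV. riemann L i i x y) = CARD('n) * (lam x y * E x y) - 1/2 * lam x y * (\<Sum>i\<in>UNIV. y $ i * dy i E x y)"
    using assms by (simp add: riemann_scalar sum_subtractf sum_distrib_left mult_ac)
  then show ?thesis using hom_euler[OF hom_E assms] dim by (simp add: algebra_simps of_nat_diff)
qed

text \<open>The trace of the Riemann curvature determines \<open>lam\<close> as a quotient of smooth
  functions, since \<open>E\<close> has no zeros on \<open>S\<close>.\<close>

lemma sm_lam [simp]: "sm lam"
proof -
  have "sm (\<lambda>x y. (\<Sum>i\<in>UNIV. riemann L i i x y) / ((CARD('n) - 1) * E x y))"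
    by (rule sm_divide) (use E_pos dim in \<open>fastforce intro: sm_sum sm_mult sm_riemann sm_const sm_power2 sm_L\<close>)+
  moreover have "lam x y = (\<Sum>i\<in>UNIV. riemann L i i x y) / ((CARD('n) - 1) * E x y)" if "(x, y) \<in> S" for x y
    using trace_riemann[OF that] E_pos[OF that] dim by simp
  ultimately show ?thesis by (subst sm_cong)
qed

text \<open>In the trace identity both the Riemann curvature and \<open>E\<close> have degree 2,
  which leaves degree 0 for \<open>lam\<close>.\<close>

lemma hom_lam: "hom 0 lam"
  unfolding hom_def
proof (intro conjI allI impI)
  fix x y assume xy: "(x, y) \<in> S"
  let ?c = "real (CARD('n) - 1)"
  have "dy k (\<lambda>x y. \<Sum>i\<in>UNIV. riemann L i i x y) x y = dy k (\<lambda>x y. ?c * (lam x y * E x y)) x y" for k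
    by (rule partial_cong[OF partial_dy trace_riemann _ xy]) simp_all
  then have "euler (\<lambda>x y. \<Sum>i\<in>UNIV. riemann L i i x y) x y = euler (\<lambda>x y. ?c * (lam x y * E x y)) x y"
    by (simp add: euler_def)
  moreover have "euler (\<lambda>x y. \<Sum>i\<in>UNIV. riemann L i i x y) x y = 2 * (\<Sum>i\<in>UNIV. riemann L i i x y)"
    using hom_sum[of UNIV 2 "\<lambda>i. riemann L i i", OF hom_riemann] xy by (simp add: hom_def)
  moreover have "euler (\<lambda>x y. ?c * (lam x y * E x y)) x y = ?c * (lam x y * (2 * E x y) + euler lam x y * E x y)"
    using xy hom_E by (simp add: euler_cmult euler_mult hom_def)
  ultimately have "?c * (euler lam x y * E x y) = 0"
    by (simp add: trace_riemann[OF xy] algebra_simps)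
  then show "euler lam x y = 0 * lam x y" using E_pos[OF xy] dim by simp
qed simp

text \<open>\<open>phi\<close> and \<open>om\<close> split the Riemann curvature into the
  coefficient of the Kronecker delta and that of \<open>- y $ i\<close>. The 1/2 in
  \<open>om\<close> comes from \<open>y_low_eq\<close>.\<close>

definition phi :: "'n fld" where "phi = (\<lambda>x y. lam x y * E x y)"
definition om :: "'n \<Rightarrow> 'n fld" where "om k = (\<lambda>x y. 1/2 * (lam x y * dy k E x y))"

lemma sm_phi_om [simp]: "sm phi" "sm (om k)"
  unfolding phi_def om_def by (simp_all del: times_divide_eq_left)

lemma riemann_phi_om:
  "(x, y) \<in> S \<Longrightarrow> riemann L i k x y = (if i = k then 1 else 0) * phi x y - y $ i * om k x y"
  using riemann_scalar[of x y i k] by (simp add: phi_def om_def)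

lemma dy_riemann_phi_om:
  assumes "(x, y) \<in> S"
  shows "dy l (riemann L i k) x y = (if i = k then 1 else 0) * dy l phi x y - y $ i * dy l (om k) x y
    - (if i = l then 1 else 0) * om k x y"
  by (subst partial_cong[OF partial_dy riemann_phi_om _ assms])
    (use assms in \<open>simp_all add: dy_simps dy_coord\<close>)

lemma dy_dy_riemann_phi_om:
  assumes "(x, y) \<in> S"
  shows "dy m (dy l (riemann L i k)) x y = (if i = k then 1 else 0) * dy m (dy l phi) x y
    - y $ i * dy m (dy l (om k)) x y
    - (if i = m then 1 else 0) * dy l (om k) x y - (if i = l then 1 else 0) * dy m (om k) x y"
  by (subst partial_cong[OF partial_dy dy_riemann_phi_om _ assms])
    (use assms in \<open>simp_all add: dy_simps dy_coord\<close>)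

end

section \<open>The flag curvature does not depend on the direction\<close>

locale GBW_chart = scalar_curvature_chart U L lam
  for U :: "(real ^ 'n::finite) set" and L and lam +
  assumes cyclic: "\<And>x y k l m. (x, y) \<in> S \<Longrightarrow>
    \<exists>\<tau>. \<forall>i. dy m (dy l (riemann L i k)) x y + dy k (dy m (riemann L i l)) x y
      + dy l (dy k (riemann L i m)) x y = \<tau> * y $ i"
begin

text \<open>In the cyclic sum every term without the factor \<open>y $ i\<close> carries a Kronecker
  delta, and the coefficient of each delta is an instance of \<open>?A\<close>. The other terms are
  absorbed into the multiple of \<open>y $ i\<close>.\<close>

lemma phi_om:
  assumes xy: "(x, y) \<in> S"
  shows "dy a (dy b phi) x y - dy a (om b) x y - dy b (om a) x y = 0" (is "?A a b = 0")
proof -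
  obtain \<tau> where \<tau>: "\<And>k l m i. dy m (dy l (riemann L i k)) x y + dy k (dy m (riemann L i l)) x y
      + dy l (dy k (riemann L i m)) x y = \<tau> k l m * y $ i"
  proof -
    have "\<forall>k l m. \<exists>\<tau>. \<forall>i. dy m (dy l (riemann L i k)) x y + dy k (dy m (riemann L i l)) x y
      + dy l (dy k (riemann L i m)) x y = \<tau> * y $ i"
      using cyclic[OF xy] by blast
    then show ?thesis using that by metis
  qed
  have sym: "dy a (dy b phi) x y = dy b (dy a phi) x y" for a b
    using xy by (simp add: dy_dy)
  show ?thesis
  proof (rule kronecker_symmetrization_eq_0[of y ?A])
    show "CARD('n) \<ge> 2" "y \<noteq> 0" using dim xy by (auto simp: S_iff)
    show "?A a b = ?A b a" for a b using sym[of a b] by simp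
    show "(if i = k then 1 else 0) * ?A l m + (if i = l then 1 else 0) * ?A k m + (if i = m then 1 else 0) * ?A k l
      = (\<tau> k l m + dy m (dy l (om k)) x y + dy k (dy m (om l)) x y + dy l (dy k (om m)) x y) * y $ i" for i k l m
      using \<tau>[of m l i k] unfolding dy_dy_riemann_phi_om[OF xy] sym[of m l] sym[of m k] sym[of l k]
      by (simp add: algebra_simps)
  qed
qed

text \<open>The Hessian of \<open>E\<close> drops out: \<open>phi\<close> contributes it once with
  weight \<open>lam\<close>, and each of the two derivatives of \<open>om\<close> subtracts half of
  that.\<close>

lemma lam_hessian:
  assumes xy: "(x, y) \<in> S"
  shows "E x y * dy a (dy b lam) x y + 1/2 * (dy a lam x y * dy b E x y + dy b lam x y * dy a E x y) = 0"
proof -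
  have s: "dy b (dy a E) x y = dy a (dy b E) x y" using xy by (simp add: dy_dy)
  have "dy b phi x y = lam x y * dy b E x y + dy b lam x y * E x y" if "(x, y) \<in> S" for x y
    unfolding phi_def using that by (simp add: dy_simps)
  then have "dy a (dy b phi) x y = dy a (\<lambda>x y. lam x y * dy b E x y + dy b lam x y * E x y) x y"
    by (rule partial_cong[OF partial_dy _ _ xy]) simp_all
  then have 1: "dy a (dy b phi) x y = lam x y * dy a (dy b E) x y + dy a lam x y * dy b E x y
       + dy b lam x y * dy a E x y + dy a (dy b lam) x y * E x y"
    using xy by (simp add: dy_simps)
  have 2: "dy a (om b) x y = 1/2 * (lam x y * dy a (dy b E) x y + dy a lam x y * dy b E x y)" for a b
    unfolding om_def using xy by (simp add: dy_simps del: times_divide_eq_left)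
  show ?thesis using phi_om[OF xy, of a b] unfolding 1 2 s by (simp add: algebra_simps)
qed

text \<open>Differentiating \<open>lam_hessian\<close> once more and antisymmetrizing in
  \<open>k\<close>, \<open>m\<close> removes the third derivatives of \<open>lam\<close>; the second
  ones are eliminated by \<open>lam_hessian\<close> itself. The brackets are \<open>2 * E\<close>
  times the angular metric g_jk - y_j y_k / E.\<close>

lemma lam_angular:
  assumes xy: "(x, y) \<in> S"
  shows "dy m lam x y * (E x y * dy j (dy k E) x y - 1/2 * dy j E x y * dy k E x y)
       = dy k lam x y * (E x y * dy j (dy m E) x y - 1/2 * dy j E x y * dy m E x y)"
proof -
  have d: "dy c E x y * dy j (dy b lam) x y + E x y * dy c (dy j (dy b lam)) x y
    + 1/2 * (dy c (dy j lam) x y * dy b E x y + dy j lam x y * dy c (dy b E) x y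
           + dy c (dy b lam) x y * dy j E x y + dy b lam x y * dy c (dy j E) x y) = 0" for b c
  proof -
    have "dy c (\<lambda>x y. E x y * dy j (dy b lam) x y + 1/2 * (dy j lam x y * dy b E x y + dy b lam x y * dy j E x y)) x y
      = dy c (\<lambda>x y. 0) x y"
      by (rule partial_cong[OF partial_dy lam_hessian _ xy]) (simp_all del: times_divide_eq_left)
    then show ?thesis using xy by (simp add: dy_simps algebra_simps del: times_divide_eq_left)
  qed
  have s: "dy k (dy j f) x y = dy j (dy k f) x y" "dy m (dy j f) x y = dy j (dy m f) x y"
      "dy m (dy k f) x y = dy k (dy m f) x y" if "sm f" for f
    using xy that by (simp_all add: dy_dy)
  have t: "dy m (dy j (dy k lam)) x y = dy k (dy j (dy m lam)) x y"
  proof -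
    have "dy m (dy j (dy k lam)) x y = dy j (dy m (dy k lam)) x y" using xy by (simp add: dy_dy)
    also have "\<dots> = dy j (dy k (dy m lam)) x y" using xy by (simp add: dy_dy_cong)
    also have "\<dots> = dy k (dy j (dy m lam)) x y" using xy by (simp add: dy_dy)
    finally show ?thesis .
  qed
  let ?e = "E x y"
  have 1: "dy k E x y * dy j (dy m lam) x y - dy m E x y * dy j (dy k lam) x y
    + 1/2 * (dy j (dy k lam) x y * dy m E x y - dy j (dy m lam) x y * dy k E x y
      + dy m lam x y * dy j (dy k E) x y - dy k lam x y * dy j (dy m E) x y) = 0"
    using d[of k m] d[of m k] unfolding t by (simp add: s algebra_simps)
  have 2: "?e * dy j (dy b lam) x y = - 1/2 * (dy j lam x y * dy b E x y + dy b lam x y * dy j E x y)" for b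
    using lam_hessian[OF xy, of j b] by simp
  \<comment> \<open>The factor \<open>2 * ?e\<close> brings the second derivatives of
    \<open>lam\<close> into the shape \<open>?e * dy j (dy b lam)\<close>, which \<open>2\<close>
    expresses by first derivatives.\<close>
  have "dy k E x y * (?e * dy j (dy m lam) x y) - dy m E x y * (?e * dy j (dy k lam) x y)
    + ?e * (dy m lam x y * dy j (dy k E) x y - dy k lam x y * dy j (dy m E) x y) = 0"
    using arg_cong[OF 1, of "\<lambda>z. 2 * ?e * z"] by (simp add: algebra_simps)
  then show ?thesis unfolding 2 by (simp add: algebra_simps)
qed

text \<open>The inverse metric sends the differential of \<open>E\<close> to \<open>2 * y\<close>.
  The quadratic terms of \<open>lam_angular\<close> thus become Euler sums, of \<open>E\<close> on
  the left and of \<open>lam\<close> on the right.\<close>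

lemma dy_lam:
  assumes xy: "(x, y) \<in> S"
  shows "dy m lam x y = 0"
proof -
  define g where "g i j = g_mat L x y $ i $ j" for i j
  define h where "h i j = g_inv L x y $ i $ j" for i j
  have gE: "dy i (dy j E) x y = 2 * g i j" for i j by (simp add: g_def g_mat_def)
  have g_sym': "g i j = g j i" for i j using g_sym[OF xy] by (simp add: g_def)
  have gh: "(\<Sum>k\<in>UNIV. g j k * h k l) = (if j = l then 1 else 0)" for j l
    using arg_cong[OF g_inv_right[OF xy], of "\<lambda>M. M $ j $ l"]
    by (simp add: g_def h_def matrix_matrix_mult_def mat_def)
  have hg: "(\<Sum>k\<in>UNIV. h j k * g k l) = (if j = l then 1 else 0)" for j l
    using arg_cong[OF g_inv_right[OF xy, unfolded matrix_left_right_inverse], of "\<lambda>M. M $ j $ l"]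
    by (simp add: g_def h_def matrix_matrix_mult_def mat_def)
  have Ey: "dy k E x y = 2 * (\<Sum>a\<in>UNIV. g k a * y $ a)" for k
    using y_low_eq[OF xy, of k] by (simp add: y_low_def g_def)
  have hE: "(\<Sum>j\<in>UNIV. h k j * dy j E x y) = 2 * y $ k" for k
  proof -
    have "(\<Sum>j\<in>UNIV. h k j * dy j E x y) = 2 * (\<Sum>a\<in>UNIV. (\<Sum>j\<in>UNIV. h k j * g j a) * y $ a)"
      unfolding Ey by (simp add: sum_distrib_left sum_distrib_right mult_ac) (subst sum.swap, simp)
    then show ?thesis by (simp add: hg)
  qed
  let ?e = "E x y"
  have yl: "(\<Sum>k\<in>UNIV. dy k lam x y * y $ k) = 0"
    using hom_euler[OF hom_lam xy] by (simp add: mult.commute)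
  have yE: "(\<Sum>k\<in>UNIV. y $ k * dy k E x y) = 2 * ?e" using hom_euler[OF hom_E xy] by simp
  have "(\<Sum>k\<in>UNIV. \<Sum>j\<in>UNIV. h k j * (dy m lam x y * (?e * dy j (dy k E) x y - 1/2 * dy j E x y * dy k E x y)))
    = (\<Sum>k\<in>UNIV. dy m lam x y * (2 * ?e * (\<Sum>j\<in>UNIV. h k j * g j k) - 1/2 * (\<Sum>j\<in>UNIV. h k j * dy j E x y) * dy k E x y))"
    unfolding gE by (simp add: sum_distrib_left sum_distrib_right sum_subtractf right_diff_distrib mult_ac)
  also have "\<dots> = dy m lam x y * (2 * ?e * CARD('n) - (\<Sum>k\<in>UNIV. y $ k * dy k E x y))"
    unfolding hg hE by (simp add: sum_subtractf right_diff_distrib sum_distrib_left)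
  finally have 1: "(\<Sum>k\<in>UNIV. \<Sum>j\<in>UNIV. h k j * (dy m lam x y * (?e * dy j (dy k E) x y - 1/2 * dy j E x y * dy k E x y)))
    = dy m lam x y * (2 * ?e * CARD('n) - 2 * ?e)" by (simp add: yE)
  have "(\<Sum>k\<in>UNIV. \<Sum>j\<in>UNIV. h k j * (dy k lam x y * (?e * dy j (dy m E) x y - 1/2 * dy j E x y * dy m E x y)))
    = (\<Sum>k\<in>UNIV. dy k lam x y * (2 * ?e * (\<Sum>j\<in>UNIV. h k j * g j m) - 1/2 * (\<Sum>j\<in>UNIV. h k j * dy j E x y) * dy m E x y))"
    unfolding gE by (simp add: sum_distrib_left sum_distrib_right sum_subtractf right_diff_distrib mult_ac)
  also have "\<dots> = 2 * ?e * (\<Sum>k\<in>UNIV. dy k lam x y * (if k = m then 1 else 0)) - (\<Sum>k\<in>UNIV. dy k lam x y * y $ k) * dy m E x y"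
  proof -
    have "dy k lam x y * (2 * ?e * (if k = m then 1 else 0) - 1/2 * (2 * y $ k) * dy m E x y)
      = 2 * ?e * (dy k lam x y * (if k = m then 1 else 0)) - dy k lam x y * y $ k * dy m E x y" for k
      by (simp add: algebra_simps)
    then show ?thesis
      unfolding hg hE by (simp only: sum_subtractf sum_distrib_left sum_distrib_right)
  qed
  finally have 2: "(\<Sum>k\<in>UNIV. \<Sum>j\<in>UNIV. h k j * (dy k lam x y * (?e * dy j (dy m E) x y - 1/2 * dy j E x y * dy m E x y)))
    = 2 * ?e * dy m lam x y" by (simp add: yl)
  have "dy m lam x y * (2 * ?e * CARD('n) - 2 * ?e) = 2 * ?e * dy m lam x y"
    using 1 2 lam_angular[OF xy, of m] by simp
  then have "dy m lam x y * ?e * (real CARD('n) - 2) = 0" by (simp add: algebra_simps)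
  then show ?thesis using E_pos[OF xy] dim by simp
qed

end

section \<open>Schur's lemma\<close>

context finsler_chart
begin

lemma delta_eq: "delta L m f = (\<lambda>x y. dx m f x y - (\<Sum>r\<in>UNIV. dy m (G r) x y * dy r f x y))"
  unfolding delta_def spray1_def by (intro ext) simp

lemma sm_delta [simp]: "sm f \<Longrightarrow> sm (delta L m f)"
  unfolding delta_eq by simp

lemma delta_cong:
  assumes "\<And>x y. (x, y) \<in> S \<Longrightarrow> f x y = g x y" "sm f" "(x, y) \<in> S"
  shows "delta L m f x y = delta L m g x y"
  unfolding delta_eq using partial_cong[OF partial_dx assms] partial_cong[OF partial_dy assms] by simp

lemma delta_diff:
  "sm f \<Longrightarrow> sm g \<Longrightarrow> (x, y) \<in> S \<Longrightarrow> delta L m (\<lambda>x y. f x y - g x y) x y = delta L m f x y - delta L m g x y"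
  unfolding delta_eq by (simp add: dx_simps dy_simps right_diff_distrib sum_subtractf)

lemma delta_mult:
  assumes "sm f" "sm g" "(x, y) \<in> S"
  shows "delta L m (\<lambda>x y. f x y * g x y) x y = f x y * delta L m g x y + delta L m f x y * g x y"
  unfolding delta_eq using assms
  by (simp add: dx_simps dy_simps ring_distribs sum.distrib sum_distrib_left sum_distrib_right mult_ac)

lemma delta_cmult:
  "sm g \<Longrightarrow> (x, y) \<in> S \<Longrightarrow> delta L m (\<lambda>x y. c * g x y) x y = c * delta L m g x y"
  unfolding delta_eq by (simp add: dx_simps dy_simps ring_distribs sum_distrib_left mult_ac)

lemma delta_sum:
  assumes "\<And>i. i \<in> I \<Longrightarrow> sm (f i)" "(x, y) \<in> S"
  shows "delta L m (\<lambda>x y. \<Sum>i\<in>I. f i x y) x y = (\<Sum>i\<in>I. delta L m (f i) x y)"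
proof -
  have "(\<Sum>r\<in>UNIV. dy m (G r) x y * (\<Sum>i\<in>I. dy r (f i) x y)) = (\<Sum>i\<in>I. \<Sum>r\<in>UNIV. dy m (G r) x y * dy r (f i) x y)"
    by (subst sum.swap) (simp add: sum_distrib_left)
  then show ?thesis
    unfolding delta_eq using assms by (simp add: dx_simps dy_simps sum_subtractf)
qed

text \<open>Expanding one double derivative, everything except the last sum is symmetric in
  \<open>k\<close>, \<open>l\<close>. What survives is a vertical derivative whose coefficients are
  the curvature of the nonlinear connection.\<close>

lemma delta_commutator:
  assumes "sm f" "(x, y) \<in> S"
  shows "delta L k (delta L l f) x y - delta L l (delta L k f) x y =
    - (\<Sum>r\<in>UNIV. (delta L k (dy l (G r)) x y - delta L l (dy k (G r)) x y) * dy r f x y)"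
proof -
  have e: "delta L k (delta L l f) x y = dx k (dx l f) x y
    - (\<Sum>r\<in>UNIV. dy k (G r) x y * dx l (dy r f) x y)
    - (\<Sum>r\<in>UNIV. dy l (G r) x y * dx k (dy r f) x y)
    + (\<Sum>r\<in>UNIV. \<Sum>s\<in>UNIV. dy l (G r) x y * dy k (G s) x y * dy s (dy r f) x y)
    - (\<Sum>r\<in>UNIV. delta L k (dy l (G r)) x y * dy r f x y)" for k l
  proof -
    have "delta L k (delta L l f) x y = delta L k (dx l f) x y
      - (\<Sum>r\<in>UNIV. dy l (G r) x y * delta L k (dy r f) x y)
      - (\<Sum>r\<in>UNIV. delta L k (dy l (G r)) x y * dy r f x y)"
      unfolding delta_eq[of l f] using assms
      by (simp add: delta_diff delta_sum delta_mult sum.distrib)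
    then show ?thesis
      by (simp add: delta_eq[of k "dx l f"] delta_eq[of k "dy _ f"] right_diff_distrib sum_subtractf
        sum_distrib_left mult.assoc dy_dx assms)
  qed
  have "(\<Sum>r\<in>UNIV. \<Sum>s\<in>UNIV. dy l (G r) x y * dy k (G s) x y * dy s (dy r f) x y)
     = (\<Sum>s\<in>UNIV. \<Sum>r\<in>UNIV. dy k (G s) x y * dy l (G r) x y * dy r (dy s f) x y)"
    by (subst sum.swap) (use assms in \<open>simp add: dy_dy[of f x y] mult_ac\<close>)
  then show ?thesis
    unfolding e[of k l] e[of l k] using assms
    by (simp add: dx_dx[of f x y k l] left_diff_distrib sum_subtractf)
qed

text \<open>Antisymmetrization kills the \<open>Sp\<close> terms. The remaining ones occur with
  weight 2 in one summand and 1 in the other, hence the factor 3.\<close>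

lemma riemann_curl:
  assumes "(x, y) \<in> S"
  shows "dy l (riemann L i k) x y - dy k (riemann L i l) x y
    = 3 * (delta L k (dy l (G i)) x y - delta L l (dy k (G i)) x y)"
proof -
  have s: "dy k (dy l f) x y = dy l (dy k f) x y" if "sm f" for f using assms that by (simp add: dy_dy)
  have s': "dy l (dy r (G i)) x y = dy r (dy l (G i)) x y" "dy k (dy r (G i)) x y = dy r (dy k (G i)) x y" for r
    using assms by (simp_all add: dy_dy)
  have "Sp (dy k (dy l (G i))) x y = Sp (dy l (dy k (G i))) x y"
    by (rule Sp_cong[OF dy_dy]) (use assms in simp_all)
  then show ?thesis
    unfolding dy_riemann[OF assms] delta_eq s' by (simp add: s algebra_simps)
qed

text \<open>The vertical derivative of \<open>delta_E\<close>: the covector \<open>dy m E\<close> is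
  parallel for the horizontal Berwald derivative.\<close>

lemma delta_dy_E:
  assumes "(x, y) \<in> S"
  shows "delta L k (dy m E) x y = (\<Sum>r\<in>UNIV. dy m (dy k (G r)) x y * dy r E x y)"
proof -
  have "dy m (delta L k E) x y = dy m (\<lambda>x y. 0) x y"
    by (rule partial_cong[OF partial_dy delta_E _ assms]) simp_all
  then show ?thesis
    unfolding delta_eq using assms by (simp add: dy_simps dy_dx dy_dy[of E x y m] sum.distrib)
qed

end

context scalar_curvature_chart
begin

context
  assumes dy_lam_0: "\<And>x y k. (x, y) \<in> S \<Longrightarrow> dy k lam x y = 0"
begin

text \<open>The curvature of the nonlinear connection, see \<open>curv_eq\<close>.\<close>

definition curv :: "'n \<Rightarrow> 'n \<Rightarrow> 'n \<Rightarrow> 'n fld" where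
  "curv i k l = (\<lambda>x y. 1/2 * (lam x y * (dy l E x y * (if i = k then 1 else 0) - dy k E x y * (if i = l then 1 else 0))))"

text \<open>Now that \<open>lam\<close> has no vertical derivative, each delta in
  \<open>riemann_curl\<close> receives weight 1 from \<open>phi\<close> and 1/2 from
  \<open>om\<close>; a third of 3/2 is the 1/2 in \<open>curv\<close>. The terms with
  \<open>y $ i\<close> cancel by symmetry of the Hessian of \<open>E\<close>.\<close>

lemma curv_eq:
  assumes "(x, y) \<in> S"
  shows "delta L k (dy l (G i)) x y - delta L l (dy k (G i)) x y = curv i k l x y"
proof -
  have o: "dy l (om k) x y = 1/2 * (lam x y * dy l (dy k E) x y)" for k l
    unfolding om_def using assms by (simp add: dy_simps dy_lam_0 del: times_divide_eq_left)
  have p: "dy k phi x y = lam x y * dy k E x y" for k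
    unfolding phi_def using assms by (simp add: dy_simps dy_lam_0)
  have "dy k (dy l E) x y = dy l (dy k E) x y" using assms by (simp add: dy_dy)
  then show ?thesis
    using riemann_curl[OF assms, of l i k]
    unfolding dy_riemann_phi_om[OF assms] o p by (simp add: curv_def om_def algebra_simps)
qed

lemma sm_curv [simp]: "sm (curv i k l)"
  unfolding curv_def by (simp del: times_divide_eq_left)

lemma delta_curv:
  assumes "(x, y) \<in> S"
  shows "delta L m (curv i k l) x y =
    1/2 * (dx m lam x y * (dy l E x y * (if i = k then 1 else 0) - dy k E x y * (if i = l then 1 else 0))
      + lam x y * (delta L m (dy l E) x y * (if i = k then 1 else 0) - delta L m (dy k E) x y * (if i = l then 1 else 0)))"
proof -
  have c: "delta L m (\<lambda>x y. f x y * c) x y = delta L m f x y * c" if "sm f" for f c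
    using delta_cmult[OF that assms, of m c] by (simp add: mult.commute)
  have d: "delta L m lam x y = dx m lam x y" unfolding delta_eq using assms by (simp add: dy_lam_0)
  show ?thesis
    unfolding curv_def using assms
    by (simp add: delta_cmult delta_mult delta_diff c d algebra_simps del: times_divide_eq_left)
qed

text \<open>The cyclic sum regroups into commutators of horizontal derivations applied to the
  coefficients of the nonlinear connection, and \<open>delta_commutator\<close> evaluates
  these.\<close>

lemma bianchi:
  assumes xy: "(x, y) \<in> S"
  shows "delta L k (curv i l m) x y + delta L l (curv i m k) x y + delta L m (curv i k l) x y
   = - (\<Sum>r\<in>UNIV. curv r k l x y * dy r (dy m (G i)) x y) - (\<Sum>r\<in>UNIV. curv r l m x y * dy r (dy k (G i)) x y)
     - (\<Sum>r\<in>UNIV. curv r m k x y * dy r (dy l (G i)) x y)"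
proof -
  have e: "delta L k (curv i l m) x y = delta L k (delta L l (dy m (G i))) x y - delta L k (delta L m (dy l (G i))) x y" for k l m
  proof -
    have "delta L k (curv i l m) x y = delta L k (\<lambda>x y. delta L l (dy m (G i)) x y - delta L m (dy l (G i)) x y) x y"
      by (rule delta_cong) (use curv_eq xy in simp_all)
    then show ?thesis using xy by (simp add: delta_diff)
  qed
  have c: "delta L k (delta L l (dy m (G i))) x y - delta L l (delta L k (dy m (G i))) x y
    = - (\<Sum>r\<in>UNIV. curv r k l x y * dy r (dy m (G i)) x y)" for k l m
    using delta_commutator[OF _ xy, of "dy m (G i)" k l] curv_eq[OF xy] by simp
  show ?thesis
    unfolding e using c[of k l m] c[of l m k] c[of m k l] by simp
qed

lemma dx_lam_dy_E:
  assumes xy: "(x, y) \<in> S"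
  shows "dx k lam x y * dy m E x y = dx m lam x y * dy k E x y"
proof (cases "k = m")
  case False
  \<comment> \<open>Using \<open>i\<close> both as upper index and as the third lower index of
    \<open>bianchi\<close>, with \<open>i\<close> different from \<open>k\<close> and
    \<open>m\<close>, leaves one delta for each of the two \<open>x\<close>-derivatives of
    \<open>lam\<close>. All other terms cancel by the symmetries \<open>C\<close> and
    \<open>D\<close>.\<close>
  have "\<exists>i. i \<noteq> k \<and> i \<noteq> m"
    using ex_index_notin[of "{k, m}"] dim False by auto
  then obtain i where i: "i \<noteq> k" "i \<noteq> m" by blast
  have C: "dy a (dy b (G r)) x y = dy b (dy a (G r)) x y" for a b r using xy by (simp add: dy_dy)
  have D: "delta L a (dy b E) x y = delta L b (dy a E) x y" for a b
    unfolding delta_dy_E[OF xy] C[of a b] ..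
  have s: "(\<Sum>r\<in>UNIV. curv r a b x y * dy r (dy c (G i)) x y)
    = 1/2 * (lam x y * (dy b E x y * dy a (dy c (G i)) x y - dy a E x y * dy b (dy c (G i)) x y))" for a b c
  proof -
    have "curv r a b x y * z = 1/2 * lam x y * dy b E x y * ((if r = a then 1 else 0) * z)
       - 1/2 * lam x y * dy a E x y * ((if r = b then 1 else 0) * z)" for r z
      by (simp add: curv_def algebra_simps)
    then show ?thesis
      by (simp only: sum_subtractf sum_distrib_left[symmetric] sum_kronecker) (simp add: algebra_simps)
  qed
  show ?thesis
    using bianchi[OF xy, of k i i m] i False
    unfolding delta_curv[OF xy] s D[of k i] D[of k m] D[of m i] C[of k i] C[of k m] C[of m i]
    by (simp add: algebra_simps)
qed simp

lemma lam_fibre_constant: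
  assumes "x \<in> U" "y \<noteq> 0" "y' \<noteq> 0"
  shows "lam x y = lam x y'"
  by (rule dy_constant) (use assms dim dy_lam_0 in \<open>auto simp: S_iff\<close>)

text \<open>The covector \<open>v\<close> of \<open>x\<close>-derivatives is the same for all fibre
  directions, so \<open>dx_lam_dy_E\<close> may be tested at a nonzero \<open>z\<close> annihilated
  by \<open>v\<close>. Contraction with \<open>z\<close> leaves
  \<open>v k * (2 * E x z) = 0\<close>.\<close>

lemma dx_lam:
  assumes "x \<in> U" "y \<noteq> 0"
  shows "dx k lam x y = 0"
proof -
  have c: "dx m lam x z = dx m lam x y" if "z \<noteq> 0" for m z
  proof -
    have "((\<lambda>t. x + t *\<^sub>R axis m 1) \<longlongrightarrow> x + 0 *\<^sub>R axis m 1) (nhds (0::real))"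
      by (intro tendsto_intros filterlim_ident)
    then have "((\<lambda>t. x + t *\<^sub>R axis m 1) \<longlongrightarrow> x) (nhds (0::real))" by simp
    then have "\<forall>\<^sub>F t in nhds 0. x + t *\<^sub>R axis m 1 \<in> U"
      using open_U assms(1) topological_tendstoD by blast
    then have "\<forall>\<^sub>F t in nhds 0. lam (x + t *\<^sub>R axis m 1) z = lam (x + t *\<^sub>R axis m 1) y"
      by eventually_elim (rule lam_fibre_constant[OF _ that assms(2)])
    then show ?thesis unfolding dx_def by (intro deriv_cong_ev) auto
  qed
  define v where "v m = dx m lam x y" for m
  have "\<exists>q. q \<noteq> k"
    using ex_index_notin[of "{k}"] dim by auto
  then obtain q where q: "q \<noteq> k" by blast
  show ?thesis
  proof (cases "v k = 0 \<and> v q = 0")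
    case False
    \<comment> \<open>The kernel vector of \<open>v\<close> in the plane of the axes
      \<open>k\<close> and \<open>q\<close>; it is nonzero exactly because of the case
      assumption.\<close>
    define z :: "real ^ 'n" where "z = v q *\<^sub>R axis k 1 - v k *\<^sub>R axis q 1"
    have zi: "z $ i = v q * (if i = k then 1 else 0) - v k * (if i = q then 1 else 0)" for i
      by (simp add: z_def axis_def)
    have "z $ k = v q" "z $ q = - v k" using q by (simp_all add: zi)
    then have "z \<noteq> 0" using False by auto
    then have xz: "(x, z) \<in> S" using assms by (simp add: S_iff)
    have "(\<Sum>m\<in>UNIV. v m * z $ m) = (\<Sum>m\<in>UNIV. v q * (v m * (if m = k then 1 else 0)) - v k * (v m * (if m = q then 1 else 0)))"
      by (simp add: zi algebra_simps)
    also have "\<dots> = 0" by (simp only: sum_subtractf sum_distrib_left[symmetric] sum_kronecker) simp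
    finally have vz: "(\<Sum>m\<in>UNIV. v m * z $ m) = 0" .
    have "v k * (\<Sum>m\<in>UNIV. z $ m * dy m E x z) = (\<Sum>m\<in>UNIV. v m * z $ m) * dy k E x z"
    proof -
      have "v k * dy m E x z = v m * dy k E x z" for m
        using dx_lam_dy_E[OF xz, of k m] c[OF \<open>z \<noteq> 0\<close>] by (simp add: v_def)
      then have "z $ m * (v k * dy m E x z) = z $ m * (v m * dy k E x z)" for m by simp
      then have "v k * (z $ m * dy m E x z) = v m * z $ m * dy k E x z" for m
        by (simp only: mult.assoc mult.left_commute[of _ "z $ m"])
      then show ?thesis by (simp only: sum_distrib_left sum_distrib_right)
    qed
    then have "v k * (2 * E x z) = 0" using vz hom_euler[OF hom_E xz] by simp
    then show ?thesis using E_pos[OF xz] by (simp add: v_def)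
  qed (simp add: v_def)
qed

lemma lam_locally_constant:
  assumes "x0 \<in> U"
  shows "\<exists>B. open B \<and> x0 \<in> B \<and> B \<subseteq> U \<and> (\<exists>\<kappa>. \<forall>x\<in>B. \<forall>y. y \<noteq> 0 \<longrightarrow> lam x y = \<kappa>)"
proof -
  obtain r where r: "r > 0" "ball x0 r \<subseteq> U" using open_U assms open_contains_ball by blast
  \<comment> \<open>An arbitrary nonzero fibre vector, serving as reference point for the constant
    value.\<close>
  define e :: "real ^ 'n" where "e = axis undefined 1"
  have e: "e \<noteq> 0" by (simp add: e_def axis_eq_0_iff)
  have "lam x y = lam x0 e" if "x \<in> ball x0 r" "y \<noteq> 0" for x y
    by (rule locally_constant[of _ "ball x0 r"])
      (use r that e dim dx_lam dy_lam_0 in \<open>auto simp: S_iff subset_iff\<close>)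
  then show ?thesis using r by (intro exI[of _ "ball x0 r"]) auto
qed

end

end

section \<open>Passage to the manifold\<close>

locale atlas =
  fixes M :: "'m topology" and A :: "('m, 'n::finite) chart set"
  assumes manifold: "smooth_manifold M A"
begin

lemma chart: "c \<in> A \<Longrightarrow> is_chart M c"
  using manifold by (auto simp: smooth_manifold_def)

lemma openin_chart: "c \<in> A \<Longrightarrow> openin M (fst c)"
  using chart by (auto simp: is_chart_def)

lemma topspace_chart: "c \<in> A \<Longrightarrow> topspace (subtopology M (fst c)) = fst c"
  using openin_subset[OF openin_chart, of c] by auto

lemma inj_chart: "c \<in> A \<Longrightarrow> inj_on (snd c) (fst c)"
  using homeomorphic_imp_injective_map chart topspace_chart by (metis is_chart_def)

lemma point_of [simp]: "c \<in> A \<Longrightarrow> p \<in> fst c \<Longrightarrow> point_of c (snd c p) = p"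
  by (simp add: point_of_def inj_chart)

lemma transition_snd [simp]: "c \<in> A \<Longrightarrow> p \<in> fst c \<Longrightarrow> transition c d (snd c p) = snd d p"
  by (simp add: transition_def)

lemma open_image:
  assumes "c \<in> A" "openin M V" "V \<subseteq> fst c"
  shows "open (snd c ` V)"
proof -
  have "openin (subtopology M (fst c)) V"
    using assms by (auto simp: openin_subtopology)
  then have "openin (top_of_set (snd c ` fst c)) (snd c ` V)"
    using homeomorphic_map_openness_eq chart[OF assms(1)] by (auto simp: is_chart_def)
  moreover have "open (snd c ` fst c)" using chart[OF assms(1)] by (simp add: is_chart_def)
  ultimately show ?thesis using openin_open_trans by blast
qed

lemma transition_has_derivative:
  assumes "c \<in> A" "d \<in> A" "p \<in> fst c" "p \<in> fst d"
  shows "(transition c d has_derivative transition_deriv c d (snd c p)) (at (snd c p))"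
  unfolding transition_deriv_def using assms manifold
  by (intro smooth_onD[of "snd c ` (fst c \<inter> fst d)"]) (auto simp: smooth_manifold_def)

lemma linear_transition_deriv:
  "c \<in> A \<Longrightarrow> d \<in> A \<Longrightarrow> p \<in> fst c \<Longrightarrow> p \<in> fst d \<Longrightarrow> linear (transition_deriv c d (snd c p))"
  using transition_has_derivative has_derivative_linear by blast

lemma transition_deriv_id:
  assumes "c \<in> A" "p \<in> fst c"
  shows "transition_deriv c c (snd c p) y = y"
proof -
  have "open (snd c ` fst c)" using chart[OF assms(1)] by (simp add: is_chart_def)
  then have "(transition c c has_derivative (\<lambda>y. y)) (at (snd c p))"
    by (rule has_derivative_transform_within_open[OF has_derivative_ident]) (use assms in auto)
  from fun_cong[OF frechet_derivative_at[OF this], of y] show ?thesis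
    by (simp add: transition_deriv_def)
qed

text \<open>The chain rule applies because the two coordinate changes compose to the third on the
  image of the triple overlap, an open neighbourhood of the point.\<close>

lemma transition_deriv_cocycle:
  assumes "c \<in> A" "d \<in> A" "e \<in> A" "p \<in> fst c" "p \<in> fst d" "p \<in> fst e"
  shows "transition_deriv c e (snd c p) y = transition_deriv d e (snd d p) (transition_deriv c d (snd c p) y)"
proof -
  let ?V = "fst c \<inter> fst d \<inter> fst e"
  have op: "open (snd c ` ?V)"
    by (rule open_image) (use assms in \<open>auto intro: openin_Int openin_chart\<close>)
  have "(transition d e has_derivative transition_deriv d e (snd d p)) (at (transition c d (snd c p)))"
    using assms transition_has_derivative by simp
  from has_derivative_compose[OF transition_has_derivative this] assms
  have comp: "((\<lambda>z. transition d e (transition c d z)) has_derivative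
      (\<lambda>y. transition_deriv d e (snd d p) (transition_deriv c d (snd c p) y))) (at (snd c p))" by blast
  have "(transition c e has_derivative
      (\<lambda>y. transition_deriv d e (snd d p) (transition_deriv c d (snd c p) y))) (at (snd c p))"
    by (rule has_derivative_transform_within_open[OF comp op]) (use assms in auto)
  from fun_cong[OF frechet_derivative_at[OF this], of y] show ?thesis
    by (simp add: transition_deriv_def[of c e])
qed

lemma tangent_of_snd:
  assumes "c \<in> A" "p \<in> fst c"
  shows "tangent_of A c (snd c p) y =
    (p, \<lambda>d. if d \<in> A \<and> p \<in> fst d then transition_deriv c d (snd c p) y else 0)"
  using assms by (simp add: tangent_of_def)

lemma tangent_of_TM:
  assumes "c \<in> A" "p \<in> fst c"
  shows "tangent_of A c (snd c p) y \<in> TM M A"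
proof -
  have "p \<in> topspace M" using assms openin_subset[OF openin_chart] by blast
  moreover have "transition_deriv d e (snd d p) (transition_deriv c d (snd c p) y) = transition_deriv c e (snd c p) y"
    if "d \<in> A" "e \<in> A" "p \<in> fst d" "p \<in> fst e" for d e
    using transition_deriv_cocycle[OF assms(1) that(1,2) assms(2) that(3,4)] by (rule sym)
  ultimately show ?thesis
    unfolding tangent_of_snd[OF assms] TM_def tangent_space_def by simp
qed

lemma tangent_of_TM0:
  assumes "c \<in> A" "p \<in> fst c" "y \<noteq> 0"
  shows "tangent_of A c (snd c p) y \<in> TM0 M A"
proof -
  have "snd (tangent_of A c (snd c p) y) c \<noteq> 0"
    using assms by (simp add: tangent_of_snd transition_deriv_id)
  then show ?thesis using tangent_of_TM[OF assms(1,2), of y] by (auto simp: TM0_def)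
qed

text \<open>One component determines a tangent vector through the Jacobians, and linearity prevents
  a nonzero vector from having a zero component in a chart around its base point.\<close>

lemma TM0_tangent_of:
  assumes "c \<in> A" "p \<in> fst c" "(p, v) \<in> TM0 M A"
  shows "(p, v) = tangent_of A c (snd c p) (v c)" "v c \<noteq> 0"
proof -
  have tv: "v \<in> tangent_space A p" "v \<noteq> (\<lambda>_. 0)" using assms(3) by (simp_all add: TM0_def TM_def)
  have v: "v d = transition_deriv c d (snd c p) (v c)" if "d \<in> A" "p \<in> fst d" for d
    using tv(1) that assms(1,2) unfolding tangent_space_def by blast
  have v0: "v d = 0" if "\<not> (d \<in> A \<and> p \<in> fst d)" for d
    using tv(1) that unfolding tangent_space_def by blast
  have "v d = (if d \<in> A \<and> p \<in> fst d then transition_deriv c d (snd c p) (v c) else 0)" for d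
    using v[of d] v0[of d] by presburger
  then show "(p, v) = tangent_of A c (snd c p) (v c)"
    unfolding tangent_of_snd[OF assms(1,2)] by blast
  show "v c \<noteq> 0"
  proof
    assume "v c = 0"
    then have "v d = 0" for d
      using v[of d] v0[of d] linear_0[OF linear_transition_deriv[OF assms(1) _ assms(2), of d]]
      by (cases "d \<in> A \<and> p \<in> fst d") simp_all
    then show False using tv(2) by blast
  qed
qed

section \<open>The metric and its curvature in a single chart\<close>

lemma finsler_chart_local_rep:
  assumes F: "finsler_metric M A F" and c: "c \<in> A"
  shows "finsler_chart (snd c ` fst c) (local_rep A F c)"
proof
  show "open (snd c ` fst c)" using chart[OF c] by (simp add: is_chart_def)
  show "smooth_on {(x, y). x \<in> snd c ` fst c \<and> y \<noteq> 0} (case_prod (local_rep A F c))"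
    using F c by (simp add: finsler_metric_def slit_coords_def case_prod_unfold)
  fix x y assume x: "x \<in> snd c ` fst c" and y: "(y :: real ^ 'n) \<noteq> 0"
  show "w \<noteq> 0 \<Longrightarrow> (\<Sum>i\<in>UNIV. \<Sum>j\<in>UNIV. g_mat (local_rep A F c) x y $ i $ j * w $ i * w $ j) > 0" for w
    using F c x y by (auto simp: finsler_metric_def slit_coords_def)
  fix t :: real assume t: "t > 0"
  obtain p where p: "p \<in> fst c" "x = snd c p" using x by blast
  obtain v where v: "tangent_of A c x y = (p, v)" using tangent_of_snd[OF c p(1)] p(2) by blast
  \<comment> \<open>Homogeneity of \<open>F\<close> concerns scaling of all components at once;
    linearity of the Jacobians reduces it to scaling of \<open>y\<close>.\<close>
  have "tangent_of A c x (t *\<^sub>R y) = (p, \<lambda>d. t *\<^sub>R v d)"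
  proof -
    have v': "v = (\<lambda>d. if d \<in> A \<and> p \<in> fst d then transition_deriv c d x y else 0)"
      using v unfolding p(2) tangent_of_snd[OF c p(1)] by simp
    show ?thesis
      using linear_scale[OF linear_transition_deriv[OF c _ p(1)]]
      unfolding v' p(2) tangent_of_snd[OF c p(1)] by (simp add: fun_eq_iff)
  qed
  moreover have "(p, v) \<in> TM M A" using tangent_of_TM[OF c p(1), of y] p(2) v by simp
  ultimately show "local_rep A F c x (t *\<^sub>R y) = t * local_rep A F c x y"
    using F t v by (auto simp: local_rep_def finsler_metric_def)
qed

lemma GBW_chart_local_rep:
  assumes F: "GBW_metric M A F" and K: "has_scalar_flag_curvature A F K" and dim: "CARD('n) > 2" and c: "c \<in> A"
  shows "GBW_chart (snd c ` fst c) (local_rep A F c) (local_rep A K c)"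
proof -
  obtain \<beta> b where \<beta>: "tensor_field_1_3 A \<beta>" and b: "tensor_field_0_3 A b" and
    e: "\<And>x y j i k l. (x, y) \<in> slit_coords c \<Longrightarrow>
          berwald (local_rep A F c) j i k l x y = \<beta> c j i k l x y + b c j k l x y * y $ i \<and>
          (\<Sum>m\<in>UNIV. hcov (local_rep A F c) (\<beta> c) j i k l m x y * y $ m) = 0"
    using F c unfolding GBW_metric_def by (auto, blast)
  interpret finsler_chart "snd c ` fst c" "local_rep A F c"
    using F c by (intro finsler_chart_local_rep) (auto simp: GBW_metric_def)
  have S: "S = slit_coords c" by (simp add: S_def slit_coords_def)
  show ?thesis
  proof
    show "CARD('n) > 2" by (rule dim)
    show "riemann (local_rep A F c) i k x y = local_rep A K c x y *
        ((local_rep A F c x y)\<^sup>2 * (if i = k then 1 else 0) - y $ i * y_low (local_rep A F c) k x y)"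
      if "x \<in> snd c ` fst c" "y \<noteq> 0" for x y i k
      using K c that unfolding has_scalar_flag_curvature_def slit_coords_def by blast
    show "\<exists>\<tau>. \<forall>i. dy m (dy l (riemann (local_rep A F c) i k)) x y + dy k (dy m (riemann (local_rep A F c) i l)) x y
      + dy l (dy k (riemann (local_rep A F c) i m)) x y = \<tau> * y $ i" if "(x, y) \<in> S" for x y k l m
    proof (rule cyclic_riemann_GBW[of "\<beta> c" "b c"])
      show "sm (\<beta> c j i k l)" for j i k l
        using \<beta> c unfolding sm_def tensor_field_1_3_def unfolding S by blast
      show "sm (b c j k l)" for j k l
        using b c unfolding sm_def tensor_field_0_3_def unfolding S by blast
    qed (use e S that in auto)
  qed
qed

text \<open>The existence of nonzero tangent vectors over \<open>V\<close> is recorded so that no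
  point of \<open>V\<close> satisfies a condition on the values of \<open>K\<close>
  vacuously.\<close>

lemma flag_curvature_locally_constant:
  assumes F: "GBW_metric M A F" and K: "has_scalar_flag_curvature A F K" and dim: "CARD('n) > 2"
    and p: "p \<in> topspace M"
  obtains V \<kappa> where "openin M V" "p \<in> V" "\<And>q v. q \<in> V \<Longrightarrow> (q, v) \<in> TM0 M A \<Longrightarrow> K (q, v) = \<kappa>"
    "\<And>q. q \<in> V \<Longrightarrow> \<exists>v. (q, v) \<in> TM0 M A"
proof -
  have "p \<in> (\<Union>c\<in>A. fst c)" using p manifold unfolding smooth_manifold_def by simp
  then obtain c where c: "c \<in> A" "p \<in> fst c" by blast
  interpret GBW_chart "snd c ` fst c" "local_rep A F c" "local_rep A K c"
    by (rule GBW_chart_local_rep) fact+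
  obtain B \<kappa> where B: "open B" "snd c p \<in> B" "B \<subseteq> snd c ` fst c"
      "\<And>x y. x \<in> B \<Longrightarrow> y \<noteq> 0 \<Longrightarrow> local_rep A K c x y = \<kappa>"
    using lam_locally_constant[OF dy_lam, of "snd c p"] c by auto
  define V where "V = {q \<in> fst c. snd c q \<in> B}"
  have "continuous_map (subtopology M (fst c)) (top_of_set (snd c ` fst c)) (snd c)"
    using chart[OF c(1)] homeomorphic_imp_continuous_map by (auto simp: is_chart_def)
  moreover have "openin (top_of_set (snd c ` fst c)) B" using B by (simp add: open_subset)
  ultimately have "openin (subtopology M (fst c)) V"
    unfolding V_def using openin_continuous_map_preimage topspace_chart[OF c(1)] by fastforce
  then have "openin M V" using openin_trans_full openin_chart[OF c(1)] by blast
  moreover have "K (q, v) = \<kappa>" if "q \<in> V" "(q, v) \<in> TM0 M A" for q v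
  proof -
    have q: "q \<in> fst c" "snd c q \<in> B" using that(1) by (auto simp: V_def)
    show ?thesis
      using TM0_tangent_of[OF c(1) q(1) that(2)] B(4)[OF q(2), of "v c"] by (simp add: local_rep_def)
  qed
  moreover have "\<exists>v. (q, v) \<in> TM0 M A" if "q \<in> V" for q
  proof -
    have q: "q \<in> fst c" using that by (simp add: V_def)
    have "axis undefined 1 \<noteq> (0 :: real ^ 'n)" by (simp add: axis_eq_0_iff)
    from tangent_of_TM0[OF c(1) q this] show ?thesis unfolding tangent_of_snd[OF c(1) q] by blast
  qed
  moreover have "p \<in> V" using c B by (simp add: V_def)
  ultimately show ?thesis using that by blast
qed

text \<open>Near each point \<open>K\<close> has a single value, so the set \<open>T\<close> of base
  points where this is the value at a reference vector is open with open complement; connectedness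
  makes it everything.\<close>

lemma flag_curvature_constant:
  assumes F: "GBW_metric M A F" and K: "has_scalar_flag_curvature A F K" and dim: "CARD('n) > 2"
  shows "constant_on_TM0 M A K"
proof (cases "TM0 M A = {}")
  case False
  then obtain p0 v0 where p0: "(p0, v0) \<in> TM0 M A" by auto
  then have p0M: "p0 \<in> topspace M" by (simp add: TM0_def TM_def)
  define T where "T = {p \<in> topspace M. \<forall>v. (p, v) \<in> TM0 M A \<longrightarrow> K (p, v) = K (p0, v0)}"
  have dichotomy: "\<exists>V. openin M V \<and> p \<in> V \<and> (V \<subseteq> T \<or> V \<inter> T = {})" if p: "p \<in> topspace M" for p
  proof -
    obtain V \<kappa> where V: "openin M V" "p \<in> V" "\<And>q v. q \<in> V \<Longrightarrow> (q, v) \<in> TM0 M A \<Longrightarrow> K (q, v) = \<kappa>"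
        "\<And>q. q \<in> V \<Longrightarrow> \<exists>v. (q, v) \<in> TM0 M A"
      using flag_curvature_locally_constant[OF F K dim p] by blast
    have "V \<subseteq> T" if "\<kappa> = K (p0, v0)" using that V(3) openin_subset[OF V(1)] by (auto simp: T_def)
    moreover have "V \<inter> T = {}" if "\<kappa> \<noteq> K (p0, v0)"
    proof -
      have False if q: "q \<in> V" "q \<in> T" for q
      proof -
        \<comment> \<open>A nonzero vector over \<open>q\<close> gives \<open>K\<close> both the
          value \<kappa> and the reference value, which contradicts their being different.\<close>
        obtain v where "(q, v) \<in> TM0 M A" using V(4) q by blast
        then show False using V(3)[OF q(1)] q(2) \<open>\<kappa> \<noteq> K (p0, v0)\<close> by (auto simp: T_def)
      qed
      then show ?thesis by blast
    qed
    ultimately show ?thesis using V(1,2) by blast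
  qed
  have "T \<subseteq> topspace M" by (auto simp: T_def)
  have "openin M T"
    unfolding openin_subopen[of M T] using dichotomy \<open>T \<subseteq> topspace M\<close> by blast
  moreover have "openin M (topspace M - T)"
    unfolding openin_subopen[of M "topspace M - T"]
  proof
    fix p assume p: "p \<in> topspace M - T"
    then obtain V where V: "openin M V" "p \<in> V" "V \<subseteq> T \<or> V \<inter> T = {}" using dichotomy by blast
    then have "V \<subseteq> topspace M - T" using openin_subset[OF V(1)] p by blast
    then show "\<exists>V. openin M V \<and> p \<in> V \<and> V \<subseteq> topspace M - T" using V by blast
  qed
  ultimately have "T = {} \<or> T = topspace M"
    using manifold connected_space_clopen_in \<open>T \<subseteq> topspace M\<close>
    by (auto simp: smooth_manifold_def closedin_def)
  moreover have "p0 \<in> T"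
  proof -
    obtain V \<kappa> where "openin M V" and V: "p0 \<in> V" "\<And>q v. q \<in> V \<Longrightarrow> (q, v) \<in> TM0 M A \<Longrightarrow> K (q, v) = \<kappa>"
        and "\<And>q. q \<in> V \<Longrightarrow> \<exists>v. (q, v) \<in> TM0 M A"
      using flag_curvature_locally_constant[OF F K dim p0M] by blast
    have "K (p0, v) = K (p0, v0)" if "(p0, v) \<in> TM0 M A" for v
      using V(2)[OF V(1) that] V(2)[OF V(1) p0] by simp
    then show ?thesis using p0M unfolding T_def by blast
  qed
  ultimately have T: "T = topspace M" by blast
  have "K (q, v) = K (p0, v0)" if "(q, v) \<in> TM0 M A" for q v
  proof -
    have "q \<in> T" using that unfolding T by (simp add: TM0_def TM_def)
    then show ?thesis using that unfolding T_def by blast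
  qed
  then show ?thesis unfolding constant_on_TM0_def by (intro exI[of _ "K (p0, v0)"]) (simp add: split_paired_all)
qed (simp add: constant_on_TM0_def)

end

theorem lemma3p5:
  fixes M :: "'m topology" and A :: "('m, 'n::finite) chart set"
  assumes "smooth_manifold M A" and "CARD('n) > 2"
  shows "\<not> (\<exists>F K. finsler_metric M A F \<and> has_scalar_flag_curvature A F K \<and>
                 \<not> constant_on_TM0 M A K \<and> GBW_metric M A F)"
proof -
  interpret atlas M A by unfold_locales (rule assms(1))
  show ?thesis using flag_curvature_constant assms(2) by blast
qed

end
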